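(* If $U$ and $V$ are two finite sets of numbers from $(0,1)$ and $\tau(U)\equiv \tau(V)$ (the words $\tau(U)$ and $\tau(V)$ are equal letter by letter), then the subgroups $H_U$ and $H_V$ are conjugate in $\mathcal{F}$.
   Context: $F$ (R. Thompson's group) is the group of all piecewise-linear increasing self-homeomorphisms of $[0,1]$ with finitely many break points of the derivative, all lying in $\mathbb{Z}[\frac12]$, and with all slopes powers of $2$. For a finite set $U\subset(0,1)$, $H_U=\{f\in F: f(x)=x \text{ for all } x\in U\}$. If $U=\{\gamma_1<\dots<\gamma_n\}$, the type $\tau(U)$ is the word of length $n$ in $\{1,2,3\}$ whose $j$-th letter is $1$ if $\gamma_j\in\mathbb{Z}[\frac12]$, $2$ if $\gamma_j$ is rational and not in $\mathbb{Z}[\frac12]$, and $3$ if $\gamma_j$ is irrational. The group $\mathcal{F}$. Consider (finite or infinite) rooted full binary trees: every vertex is a leaf or has exactly two children, the left edge being labeled $0$ and the right edge $1$. A branch is a maximal simple path starting at the root, identified with its (finite or infinite) binary label; branches are ordered left to right (lexicographically). For a finite binary word $p$, $[p]$ denotes the interval $[.p,.p1^{\mathbb{N}}]$ (binary expansions); an infinite branch $\omega$ corresponds to the single point $.\omega$. $\mathcal{F}$ consists of the triples $(T_+,T_-,\phi)$, where $T_+,T_-$ are such binary trees with the same finite number of infinite branches, and $\phi$ is an order-preserving (left to right) bijection from the branches of $T_+$ to the branches of $T_-$ taking infinite branches to infinite branches; triples are taken modulo inserting/reducing pairs of common carets (a caret being a vertex with two children, common if it occurs at corresponding branches of both trees).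 Each triple defines a homeomorphism of $[0,1]$ mapping $[p]$ linearly onto $[\phi(p)]$ for every finite branch $p$ of $T_+$ and $.\omega$ to $.\phi(\omega)$ for every infinite branch $\omega$. This identifies $\mathcal{F}$ with a subgroup of $\mathrm{Homeo}([0,1])$ containing $F$ (the triples with both trees finite); group operations are those of $\mathrm{Homeo}([0,1])$. *)

theory Defs
  imports "HOL-Analysis.Analysis" "HOL-Algebra.Bij" "HOL-Algebra.Coset"
begin

section \<open>Self-homeomorphisms of the unit interval and Thompson's group F\<close>

text \<open>As in \<^const>\<open>BijGroup\<close>, a self-map of the unit interval is a function that is
  \<^const>\<open>extensional\<close> on it; the product of \<open>f\<close> and \<open>g\<close> is \<open>f\<close> after \<open>g\<close>.\<close>

definition homeo_group :: "(real \<Rightarrow> real) monoid" where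
  "homeo_group = BijGroup {0..1}
     \<lparr>carrier := {f \<in> Bij {0..1}. \<exists>f'. homeomorphism {0..1} {0..1} f f'}\<rparr>"

definition dyadic :: "real set" where
  "dyadic = {x. \<exists>(m::int) (n::nat). x = of_int m / 2 ^ n}"

text \<open>\<open>B\<close> is a finite set containing the break points; it may contain further dyadic points.\<close>

definition thompson_F :: "(real \<Rightarrow> real) set" where
  "thompson_F = {f \<in> carrier homeo_group. strict_mono_on {0..1} f \<and>
     (\<exists>B. finite B \<and> B \<subseteq> dyadic \<and>
       (\<forall>a b. 0 \<le> a \<and> a < b \<and> b \<le> 1 \<and> {a<..<b} \<inter> B = {} \<longrightarrow>
         (\<exists>(k::int) c. \<forall>x\<in>{a..b}. f x = 2 powi k * x + c)))}"

definition fixing_subgroup :: "real set \<Rightarrow> (real \<Rightarrow> real) set" where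
  "fixing_subgroup U = {f \<in> thompson_F. \<forall>x\<in>U. f x = x}"

definition point_type :: "real \<Rightarrow> nat" where
  "point_type x = (if x \<in> dyadic then 1 else if x \<in> \<rat> then 2 else 3)"

definition type_word :: "real set \<Rightarrow> nat list" where
  "type_word U = map point_type (sorted_list_of_set U)"


section \<open>Binary trees and their branches\<close>

text \<open>A tree is the set of addresses of its vertices; \<^const>\<open>False\<close> is the label 0 (left)
  and \<^const>\<open>True\<close> the label 1 (right).\<close>

definition full_binary_tree :: "bool list set \<Rightarrow> bool" where
  "full_binary_tree T \<longleftrightarrow> [] \<in> T \<and> (\<forall>p b. p @ [b] \<in> T \<longrightarrow> p \<in> T \<and> p @ [\<not> b] \<in> T)"

datatype branch = FinBranch "bool list" | InfBranch "nat \<Rightarrow> bool"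

definition fin_branches :: "bool list set \<Rightarrow> branch set" where
  "fin_branches T = {FinBranch p | p. p \<in> T \<and> (\<forall>b. p @ [b] \<notin> T)}"

definition inf_branches :: "bool list set \<Rightarrow> branch set" where
  "inf_branches T = {InfBranch w | w. \<forall>n. map w [0..<n] \<in> T}"

definition branches :: "bool list set \<Rightarrow> branch set" where
  "branches T = fin_branches T \<union> inf_branches T"

fun letter :: "branch \<Rightarrow> nat \<Rightarrow> bool option" where
  "letter (FinBranch p) n = (if n < length p then Some (p ! n) else None)"
| "letter (InfBranch w) n = Some (w n)"

text \<open>No branch of a tree is a proper prefix of another one, so on the branches of a tree this
  is the strict lexicographic order.\<close>

definition left_of :: "branch \<Rightarrow> branch \<Rightarrow> bool" where
  "left_of a b \<longleftrightarrow>
     (\<exists>n. (\<forall>i<n. letter a i = letter b i) \<and> letter a n = Some False \<and> letter b n = Some True)"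


section \<open>The homeomorphisms defined by tree triples\<close>

definition tree_triple ::
    "bool list set \<Rightarrow> bool list set \<Rightarrow> (branch \<Rightarrow> branch) \<Rightarrow> bool" where
  "tree_triple T1 T2 \<phi> \<longleftrightarrow>
     full_binary_tree T1 \<and> full_binary_tree T2 \<and>
     finite (inf_branches T1) \<and> finite (inf_branches T2) \<and>
     card (inf_branches T1) = card (inf_branches T2) \<and>
     bij_betw \<phi> (branches T1) (branches T2) \<and>
     (\<forall>a\<in>branches T1. \<forall>b\<in>branches T1. left_of a b \<longrightarrow> left_of (\<phi> a) (\<phi> b)) \<and>
     \<phi> ` inf_branches T1 \<subseteq> inf_branches T2"

definition bin :: "(nat \<Rightarrow> bool) \<Rightarrow> real" where
  "bin w = (\<Sum>n. of_bool (w n) / 2 ^ Suc n)"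

definition pad :: "bool list \<Rightarrow> bool \<Rightarrow> nat \<Rightarrow> bool" where
  "pad p b n = (if n < length p then p ! n else b)"

abbreviation left_end :: "bool list \<Rightarrow> real" where
  "left_end p \<equiv> bin (pad p False)"

abbreviation right_end :: "bool list \<Rightarrow> real" where
  "right_end p \<equiv> bin (pad p True)"

definition induces ::
    "bool list set \<Rightarrow> (branch \<Rightarrow> branch) \<Rightarrow> (real \<Rightarrow> real) \<Rightarrow> bool" where
  "induces T \<phi> f \<longleftrightarrow>
     (\<forall>p q. FinBranch p \<in> branches T \<and> \<phi> (FinBranch p) = FinBranch q \<longrightarrow>
       (\<forall>t\<in>{0..1}. f ((1 - t) * left_end p + t * right_end p)
                    = (1 - t) * left_end q + t * right_end q)) \<and>
     (\<forall>u v. InfBranch u \<in> branches T \<and> \<phi> (InfBranch u) = InfBranch v \<longrightarrow> f (bin u) = bin v)"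

text \<open>Triples that differ by inserting or reducing common carets define the same map, so the
  quotient is represented by the set of maps defined by triples. In a triple \<open>\<phi>\<close> maps finite
  branches to finite branches, because the finite numbers of infinite branches agree; hence
  \<^const>\<open>induces\<close> prescribes the map on the whole interval.\<close>

definition tree_group :: "(real \<Rightarrow> real) monoid" where
  "tree_group = homeo_group
     \<lparr>carrier := {f \<in> carrier homeo_group. \<exists>T1 T2 \<phi>. tree_triple T1 T2 \<phi> \<and> induces T1 \<phi> f}\<rparr>"

definition conjugate_in :: "('a, 'b) monoid_scheme \<Rightarrow> 'a set \<Rightarrow> 'a set \<Rightarrow> bool" where
  "conjugate_in G H K \<longleftrightarrow>
     (\<exists>g\<in>carrier G. K = g <#\<^bsub>G\<^esub> H #>\<^bsub>G\<^esub> inv\<^bsub>G\<^esub> g)"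

end

theory Submission
  imports Defs
begin

text \<open>The subgroups are conjugated by one explicit homeomorphism \<open>G\<close> with \<open>G(U) = V\<close>. It is glued from
pieces that look like elements of \<open>F\<close>, and it can fail to be piecewise linear only at the points of
\<open>U\<close> that are not dyadic. What an element \<open>f\<close> of \<open>F\<close> fixing \<open>\<gamma> \<in> U\<close> can do near \<open>\<gamma>\<close> depends on the
type of \<open>\<gamma>\<close>.

If \<open>\<gamma>\<close> is dyadic, \<open>f\<close> has arbitrary slopes \<open>2\<^sup>k\<close> on the two sides, and \<open>G\<close> may be chosen
piecewise linear at \<open>\<gamma>\<close>. Otherwise \<open>f\<close> is linear near \<open>\<gamma>\<close>, with slope \<open>2\<^sup>k\<close>, and \<open>(2\<^sup>k - 1) \<gamma>\<close> is
dyadic, because \<open>f\<close> maps dyadic numbers to dyadic numbers. The exponents \<open>k\<close> with this property form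
a subgroup \<open>p\<int>\<close> of \<open>\<int>\<close>. It is trivial exactly for irrational \<open>\<gamma>\<close>, so then \<open>f\<close> is the
identity near \<open>\<gamma>\<close>. For rational \<open>\<gamma>\<close>, the germ of \<open>f\<close> is a power of the dilation by \<open>2\<^sup>p\<close> about
\<open>\<gamma>\<close>. If \<open>\<delta>\<close> is the corresponding point of \<open>V\<close>, with group \<open>p'\<int>\<close>, then \<open>G\<close> is built
on a fundamental domain of the dilation by \<open>2\<^bsup>-p\<^esup>\<close> about \<open>\<gamma>\<close> and extended equivariantly, so that
it carries this dilation to the dilation by \<open>2\<^bsup>-p'\<^esup>\<close> about \<open>\<delta>\<close>
(\<open>half_line_homeo\<close>, \<open>single_point_interpolation\<close>, \<open>intertwiner_through_points\<close>). Hence \<open>G f G\<^sup>-\<^sup>1\<close>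
is again linear near \<open>\<delta>\<close> with dyadic constants, and it is piecewise linear elsewhere since all germs
involved are (\<open>intertwiner_conjugate\<close>). The inverse of \<open>G\<close> has the same properties
(\<open>intertwiner_inverse\<close>), which gives both inclusions.

It remains to see that \<open>G\<close> comes from a tree triple. The finite branches of the tree are the maximal
dyadic intervals \<open>[p]\<close> that \<open>G\<close> maps linearly onto a dyadic interval \<open>[q]\<close>. Every point where \<open>G\<close> is
piecewise linear lies in such an interval (\<open>maps_cone_at_PL_point\<close>), so the infinite branches are
expansions of the finitely many exceptional points. The second tree is the tree of the inverse of
\<open>G\<close> (\<open>restrict_in_tree_group\<close>).\<close>

section \<open>Dyadic numbers\<close>

lemma dyadic_of_int [simp]: "of_int m \<in> dyadic"
  unfolding dyadic_def by (rule CollectI, rule exI[of _ m], rule exI[of _ 0]) simp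

lemma dyadic_numerals [simp]: "0 \<in> dyadic" "1 \<in> dyadic" "numeral n \<in> dyadic" "of_nat j \<in> dyadic"
  using dyadic_of_int[of 0] dyadic_of_int[of 1] dyadic_of_int[of "numeral n"] dyadic_of_int[of "int j"]
  by simp_all

lemma dyadic_add [simp]:
  assumes "x \<in> dyadic" "y \<in> dyadic" shows "x + y \<in> dyadic"
proof -
  obtain m n m' n' where "x = of_int m / 2 ^ n" "y = of_int m' / 2 ^ n'"
    using assms unfolding dyadic_def by blast
  then have "x + y = of_int (m * 2 ^ n' + m' * 2 ^ n) / 2 ^ (n + n')"
    by (simp add: add_divide_distrib power_add)
  then show ?thesis unfolding dyadic_def by blast
qed

lemma dyadic_mult [simp]:
  assumes "x \<in> dyadic" "y \<in> dyadic" shows "x * y \<in> dyadic"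
proof -
  obtain m n m' n' where "x = of_int m / 2 ^ n" "y = of_int m' / 2 ^ n'"
    using assms unfolding dyadic_def by blast
  then have "x * y = of_int (m * m') / 2 ^ (n + n')"
    by (simp add: power_add)
  then show ?thesis unfolding dyadic_def by blast
qed

lemma dyadic_minus [simp]: "x \<in> dyadic \<Longrightarrow> - x \<in> dyadic"
  using dyadic_mult[OF _ dyadic_of_int[of "-1"], of x] by simp

lemma dyadic_minus_iff [simp]: "- x \<in> dyadic \<longleftrightarrow> x \<in> dyadic"
  using dyadic_minus[of x] dyadic_minus[of "- x"] by auto

lemma dyadic_diff [simp]: "x \<in> dyadic \<Longrightarrow> y \<in> dyadic \<Longrightarrow> x - y \<in> dyadic"
  using dyadic_add[OF _ dyadic_minus, of x y] by simp

lemma dyadic_power [simp]: "x \<in> dyadic \<Longrightarrow> x ^ n \<in> dyadic"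
  by (induction n) auto

lemma dyadic_powi [simp]: "2 powi k \<in> dyadic"
proof (cases "k \<ge> 0")
  case True
  then show ?thesis by (simp add: power_int_def)
next
  case False
  then have "(2::real) powi k = of_int 1 / 2 ^ nat (- k)"
    by (simp add: power_int_def field_simps)
  then show ?thesis unfolding dyadic_def by blast
qed

lemma dyadic_add_iff:
  assumes "y \<in> dyadic" shows "x + y \<in> dyadic \<longleftrightarrow> x \<in> dyadic"
  using assms dyadic_add[of x y] dyadic_diff[of "x + y" y] by auto

lemma dyadic_powi_mult_iff [simp]: "2 powi k * x \<in> dyadic \<longleftrightarrow> x \<in> dyadic"
proof
  assume "2 powi k * x \<in> dyadic"
  then have "2 powi (- k) * (2 powi k * x) \<in> dyadic" by (rule dyadic_mult[OF dyadic_powi])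
  moreover have "2 powi (- k) * (2 powi k * x) = x"
    by (simp add: power_int_minus flip: mult.assoc)
  ultimately show "x \<in> dyadic" by simp
qed auto

lemma dyadic_between:
  assumes "a < (b::real)" obtains d where "d \<in> dyadic" "a < d" "d < b"
proof -
  obtain n where n: "inverse (2 ^ n) < b - a"
    using real_arch_pow_inv[of "b - a" "1/2"] assms by (auto simp: power_one_over field_simps)
  define m where "m = \<lfloor>a * 2 ^ n\<rfloor> + 1"
  have "a * 2 ^ n < of_int m" "of_int m \<le> a * 2 ^ n + 1" unfolding m_def by linarith+
  then have "a < of_int m / 2 ^ n" "of_int m / 2 ^ n \<le> a + inverse (2 ^ n)"
    by (auto simp: field_simps)
  moreover have "of_int m / 2 ^ n \<in> dyadic" unfolding dyadic_def by blast
  ultimately show thesis using n by (intro that[of "of_int m / 2 ^ n"]) auto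
qed

lemma two_powi_inject: "(2::real) powi k = 2 powi l \<longleftrightarrow> k = l"
  using power_int_strict_increasing[of k l "2::real"] power_int_strict_increasing[of l k "2::real"]
  by (cases k l rule: linorder_cases) auto

lemma dyadic_subset_Rats: "dyadic \<subseteq> \<rat>"
  unfolding dyadic_def by (auto intro!: Rats_divide Rats_power)

section \<open>Increasing homeomorphisms with dyadic piecewise linear germs\<close>

abbreviation inverse_map :: "(real \<Rightarrow> real) \<Rightarrow> real \<Rightarrow> real" where
  "inverse_map \<equiv> inv_into UNIV"

text \<open>A strictly increasing surjection of the line is a homeomorphism. Maps of the whole line have no end
points, so gluing, conjugating and reflecting them needs no case distinctions; the group \<open>F\<close> is
recovered by restriction to the unit interval.\<close>
definition increasing_homeo :: "(real \<Rightarrow> real) \<Rightarrow> bool" where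
  "increasing_homeo f \<longleftrightarrow> strict_mono f \<and> surj f"

lemma increasing_homeo_less_iff: "increasing_homeo f \<Longrightarrow> f x < f y \<longleftrightarrow> x < y"
  and increasing_homeo_le_iff: "increasing_homeo f \<Longrightarrow> f x \<le> f y \<longleftrightarrow> x \<le> y"
  and increasing_homeo_eq_iff: "increasing_homeo f \<Longrightarrow> f x = f y \<longleftrightarrow> x = y"
  unfolding increasing_homeo_def by (simp_all add: strict_mono_less strict_mono_less_eq strict_mono_eq)

lemma increasing_homeo_bij: "increasing_homeo f \<Longrightarrow> bij f"
  unfolding increasing_homeo_def bij_def by (auto simp: strict_mono_imp_inj_on)

lemma increasing_homeo_inv_f [simp]: "increasing_homeo f \<Longrightarrow> inverse_map f (f x) = x"
  and increasing_homeo_f_inv [simp]: "increasing_homeo f \<Longrightarrow> f (inverse_map f y) = y"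
  using increasing_homeo_bij[of f] by (simp_all add: bij_is_inj bij_is_surj surj_f_inv_f)

lemma increasing_homeo_inv [simp]:
  assumes "increasing_homeo f" shows "increasing_homeo (inverse_map f)"
  unfolding increasing_homeo_def strict_mono_def
  using assms increasing_homeo_less_iff[OF assms] increasing_homeo_bij[OF assms]
  by (metis increasing_homeo_f_inv bij_imp_bij_inv bij_is_surj)

lemma increasing_homeo_comp:
  "increasing_homeo f \<Longrightarrow> increasing_homeo g \<Longrightarrow> increasing_homeo (g \<circ> f)"
  unfolding increasing_homeo_def by (metis comp_surj comp_apply strict_mono_def)

lemma increasing_homeo_continuous:
  assumes "increasing_homeo f" shows "continuous_on A f"
proof -
  have "continuous_on UNIV f"
    using assms by (intro continuous_onI_mono)
      (auto simp: increasing_homeo_def strict_mono_less_eq)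
  then show ?thesis by (rule continuous_on_subset) auto
qed

lemma increasing_homeo_eventually:
  assumes "increasing_homeo f" "eventually P (nhds (f x))"
  shows "\<forall>\<^sub>F y in nhds x. P (f y)"
proof -
  have "continuous (at x) f" 
    using increasing_homeo_continuous[OF assms(1), of UNIV] by (simp add: continuous_on_eq_continuous_at)
  then have "filterlim f (nhds (f x)) (nhds x)"
    by (simp add: continuous_at tendsto_at_iff_tendsto_nhds)
  then show ?thesis using assms(2) by (simp add: filterlim_iff)
qed

text \<open>The germ of \<open>f\<close> at \<open>x\<close> is \<open>y \<mapsto> 2\<^sup>k y + c\<close> on the left and \<open>y \<mapsto> 2\<^sup>l y + d\<close> on the right, where the
constants \<open>c = f x - 2\<^sup>k x\<close> and \<open>d = f x - 2\<^sup>l x\<close> are dyadic; a break is allowed at dyadic \<open>x\<close> only.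
For dyadic \<open>x\<close> the condition on the constants says that \<open>f x\<close> is dyadic.\<close>
definition dyadic_PL_at :: "(real \<Rightarrow> real) \<Rightarrow> real \<Rightarrow> bool" where
  "dyadic_PL_at f x \<longleftrightarrow> (\<exists>k l::int.
     (\<forall>\<^sub>F y in nhds x. f y = f x + (if y \<le> x then 2 powi k else 2 powi l) * (y - x)) \<and>
     f x - 2 powi k * x \<in> dyadic \<and> f x - 2 powi l * x \<in> dyadic \<and> (x \<notin> dyadic \<longrightarrow> k = l))"

lemma dyadic_PL_at_dyadic_iff:
  assumes "dyadic_PL_at f x" shows "f x \<in> dyadic \<longleftrightarrow> x \<in> dyadic"
proof -
  obtain k where "f x - 2 powi k * x \<in> dyadic" using assms unfolding dyadic_PL_at_def by blast
  then show ?thesis using dyadic_add_iff[of "f x - 2 powi k * x" "2 powi k * x"] by auto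
qed

lemma dyadic_PL_at_cong:
  assumes "\<forall>\<^sub>F y in nhds x. f y = g y" shows "dyadic_PL_at f x \<longleftrightarrow> dyadic_PL_at g x"
proof -
  have "f x = g x" using assms by (rule eventually_nhds_x_imp_x)
  moreover have "(\<forall>\<^sub>F y in nhds x. f y = Q y) \<longleftrightarrow> (\<forall>\<^sub>F y in nhds x. g y = Q y)" for Q
    using assms by (auto elim: eventually_elim2)
  ultimately show ?thesis unfolding dyadic_PL_at_def by simp
qed

lemma dyadic_PL_at_comp:
  assumes f: "increasing_homeo f" and fx: "dyadic_PL_at f x" and gx: "dyadic_PL_at g (f x)"
  shows "dyadic_PL_at (g \<circ> f) x"
proof -
  obtain k l where f1: "\<forall>\<^sub>F y in nhds x. f y = f x + (if y \<le> x then 2 powi k else 2 powi l) * (y - x)"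
    and f2: "f x - 2 powi k * x \<in> dyadic" "f x - 2 powi l * x \<in> dyadic" "x \<notin> dyadic \<longrightarrow> k = l"
    using fx unfolding dyadic_PL_at_def by blast
  obtain k' l' where g1: "\<forall>\<^sub>F y in nhds (f x). g y = g (f x) + (if y \<le> f x then 2 powi k' else 2 powi l') * (y - f x)"
    and g2: "g (f x) - 2 powi k' * f x \<in> dyadic" "g (f x) - 2 powi l' * f x \<in> dyadic" "f x \<notin> dyadic \<longrightarrow> k' = l'"
    using gx unfolding dyadic_PL_at_def by blast
  have dy: "g (f x) - 2 powi (i + j) * x \<in> dyadic"
    if "g (f x) - 2 powi i * f x \<in> dyadic" "f x - 2 powi j * x \<in> dyadic" for i j :: int
  proof -
    have "g (f x) - 2 powi (i + j) * x = (g (f x) - 2 powi i * f x) + 2 powi i * (f x - 2 powi j * x)"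
      by (simp add: power_int_add algebra_simps)
    then show ?thesis using that by (simp only: dyadic_add dyadic_mult dyadic_powi)
  qed
  have "\<forall>\<^sub>F y in nhds x. (g \<circ> f) y
      = (g \<circ> f) x + (if y \<le> x then 2 powi (k' + k) else 2 powi (l' + l)) * (y - x)"
    using increasing_homeo_eventually[OF f g1] f1
  proof eventually_elim
    case (elim y)
    then show ?case
      using increasing_homeo_le_iff[OF f, of y x] by (auto simp: power_int_add split: if_splits)
  qed
  then show ?thesis unfolding dyadic_PL_at_def
    using dy[OF g2(1) f2(1)] dy[OF g2(2) f2(2)] f2(3) g2(3) dyadic_PL_at_dyadic_iff[OF fx]
    by (intro exI[of _ "k' + k"] exI[of _ "l' + l"]) (auto simp: comp_def)
qed

lemma dyadic_PL_at_inv: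
  assumes f: "increasing_homeo f" and fx: "dyadic_PL_at f x"
  shows "dyadic_PL_at (inverse_map f) (f x)"
proof -
  obtain k l where f1: "\<forall>\<^sub>F y in nhds x. f y = f x + (if y \<le> x then 2 powi k else 2 powi l) * (y - x)"
    and f2: "f x - 2 powi k * x \<in> dyadic" "f x - 2 powi l * x \<in> dyadic" "x \<notin> dyadic \<longrightarrow> k = l"
    using fx unfolding dyadic_PL_at_def by blast
  have dy: "x - 2 powi (- j) * f x \<in> dyadic" if "f x - 2 powi j * x \<in> dyadic" for j :: int
  proof -
    have "x - 2 powi (- j) * f x = - (2 powi (- j) * (f x - 2 powi j * x))"
      by (simp add: power_int_minus algebra_simps)
    then show ?thesis using that by simp
  qed
  have "\<forall>\<^sub>F z in nhds (f x). f (inverse_map f z) = f x + (if inverse_map f z \<le> x then 2 powi k else 2 powi l) * (inverse_map f z - x)"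
    using f1 by (intro increasing_homeo_eventually[OF increasing_homeo_inv[OF f]]) (simp add: f)
  then have "\<forall>\<^sub>F z in nhds (f x). inverse_map f z
      = x + (if z \<le> f x then 2 powi (- k) else 2 powi (- l)) * (z - f x)"
  proof eventually_elim
    case (elim z)
    have "inverse_map f z \<le> x \<longleftrightarrow> z \<le> f x"
      using increasing_homeo_le_iff[OF f, of "inverse_map f z" x] f by simp
    then show ?case using elim f by (auto simp: power_int_minus field_simps)
  qed
  then show ?thesis unfolding dyadic_PL_at_def
    using dy[OF f2(1)] dy[OF f2(2)] f2(3) dyadic_PL_at_dyadic_iff[OF fx] f
    by (intro exI[of _ "- k"] exI[of _ "- l"]) auto
qed

lemma dyadic_PL_at_affine:
  assumes "c \<in> dyadic" shows "dyadic_PL_at (\<lambda>y. 2 powi k * y + c) x"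
  unfolding dyadic_PL_at_def using assms
  by (intro exI[of _ k]) (auto simp: algebra_simps)

definition glue :: "real \<Rightarrow> (real \<Rightarrow> real) \<Rightarrow> (real \<Rightarrow> real) \<Rightarrow> real \<Rightarrow> real" where
  "glue m f g x = (if x \<le> m then f x else g x)"

lemma glue_simps: "x \<le> m \<Longrightarrow> glue m f g x = f x" "m < x \<Longrightarrow> glue m f g x = g x"
  "f m = g m \<Longrightarrow> m \<le> x \<Longrightarrow> glue m f g x = g x"
  unfolding glue_def by (auto dest: order.antisym)

lemma eventually_glue:
  "x < m \<Longrightarrow> \<forall>\<^sub>F y in nhds x. glue m f g y = f y"
  "m < x \<Longrightarrow> \<forall>\<^sub>F y in nhds x. glue m f g y = g y"
  using eventually_nhds_in_open[of "{..<m}" x] eventually_nhds_in_open[of "{m<..}" x]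
  by (auto elim!: eventually_mono simp: glue_def)

lemma increasing_homeo_glue:
  assumes "increasing_homeo f" "increasing_homeo g" "f m = g m"
  shows "increasing_homeo (glue m f g)"
proof -
  note f = increasing_homeo_less_iff[OF assms(1)] and g = increasing_homeo_less_iff[OF assms(2)]
  have "strict_mono (glue m f g)"
  proof (rule strict_monoI)
    fix x y :: real assume "x < y"
    then show "glue m f g x < glue m f g y"
      unfolding glue_def using f[of x y] g[of x y] f[of x m] g[of m y] assms(3)
      by (cases "x = m") auto
  qed
  moreover have "\<exists>x. glue m f g x = y" for y
  proof (cases "y \<le> f m")
    case True
    then show ?thesis
      using increasing_homeo_le_iff[OF assms(1), of "inverse_map f y" m] assms(1)
      by (intro exI[of _ "inverse_map f y"]) (auto simp: glue_def)
  next
    case False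
    then show ?thesis
      using increasing_homeo_less_iff[OF assms(2), of m "inverse_map g y"] assms(2,3)
      by (intro exI[of _ "inverse_map g y"]) (auto simp: glue_def)
  qed
  ultimately show ?thesis unfolding increasing_homeo_def surj_def by metis
qed

text \<open>At a dyadic gluing point nothing relates the slopes on the two sides.\<close>
lemma dyadic_PL_at_glue:
  assumes "f m = g m" "m \<in> dyadic"
    and f: "x \<le> m \<Longrightarrow> dyadic_PL_at f x" and g: "m \<le> x \<Longrightarrow> dyadic_PL_at g x"
  shows "dyadic_PL_at (glue m f g) x"
proof (cases x m rule: linorder_cases)
  case less
  then show ?thesis using dyadic_PL_at_cong[OF eventually_glue(1)] f by auto
next
  case greater
  then show ?thesis using dyadic_PL_at_cong[OF eventually_glue(2)] g by auto
next
  case equal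
  obtain k l where f1: "\<forall>\<^sub>F y in nhds m. f y = f m + (if y \<le> m then 2 powi k else 2 powi l) * (y - m)"
    and f2: "f m - 2 powi k * m \<in> dyadic"
    using f equal unfolding dyadic_PL_at_def by blast
  obtain k' l' where g1: "\<forall>\<^sub>F y in nhds m. g y = g m + (if y \<le> m then 2 powi k' else 2 powi l') * (y - m)"
    and g2: "g m - 2 powi l' * m \<in> dyadic"
    using g equal unfolding dyadic_PL_at_def by blast
  have "\<forall>\<^sub>F y in nhds m. glue m f g y = glue m f g m + (if y \<le> m then 2 powi k else 2 powi l') * (y - m)"
    using f1 g1 by eventually_elim (auto simp: glue_def assms(1))
  then show ?thesis
    unfolding dyadic_PL_at_def equal using f2 g2 assms(1,2)
    by (intro exI[of _ k] exI[of _ l']) (auto simp: glue_def)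
qed

text \<open>By compactness of the unit interval, having these germs everywhere already forces finitely many
breaks there; this is why a pointwise condition describes \<open>F\<close>.\<close>
definition PL_homeos :: "(real \<Rightarrow> real) set" where
  "PL_homeos = {f. increasing_homeo f \<and> (\<forall>x. dyadic_PL_at f x)}"

lemma PL_homeos_comp: "f \<in> PL_homeos \<Longrightarrow> g \<in> PL_homeos \<Longrightarrow> g \<circ> f \<in> PL_homeos"
  unfolding PL_homeos_def by (auto simp: increasing_homeo_comp dyadic_PL_at_comp)

lemma PL_homeos_inv: "f \<in> PL_homeos \<Longrightarrow> inverse_map f \<in> PL_homeos"
  unfolding PL_homeos_def
  by (auto, metis increasing_homeo_f_inv dyadic_PL_at_inv)

lemma PL_homeos_glue:
  "f \<in> PL_homeos \<Longrightarrow> g \<in> PL_homeos \<Longrightarrow> f m = g m \<Longrightarrow> m \<in> dyadic \<Longrightarrow> glue m f g \<in> PL_homeos"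
  unfolding PL_homeos_def by (auto simp: increasing_homeo_glue dyadic_PL_at_glue)

lemma increasing_homeo_affine:
  assumes "0 < s" shows "increasing_homeo (\<lambda>y. s * y + c)"
proof -
  have "s * ((z - c) / s) + c = z" for z using assms by (simp add: field_simps)
  then show ?thesis using assms unfolding increasing_homeo_def surj_def
    by (metis (no_types, lifting) add_less_cancel_right mult_less_cancel_left_pos strict_monoI)
qed

lemma PL_homeos_affine: "c \<in> dyadic \<Longrightarrow> (\<lambda>y. 2 powi k * y + c) \<in> PL_homeos"
  unfolding PL_homeos_def by (auto intro: dyadic_PL_at_affine increasing_homeo_affine)

lemma PL_homeos_translation: "c \<in> dyadic \<Longrightarrow> (\<lambda>y. y + c) \<in> PL_homeos"
  using PL_homeos_affine[of c 0] by simp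

lemma dyadic_PL_at_nondyadic:
  assumes "dyadic_PL_at f x" "x \<notin> dyadic"
  obtains k where "\<forall>\<^sub>F y in nhds x. f y = f x + 2 powi k * (y - x)" "f x - 2 powi k * x \<in> dyadic"
proof -
  obtain k l where kl: "\<forall>\<^sub>F y in nhds x. f y = f x + (if y \<le> x then 2 powi k else 2 powi l) * (y - x)"
    "f x - 2 powi k * x \<in> dyadic" "x \<notin> dyadic \<longrightarrow> k = l"
    using assms(1) unfolding dyadic_PL_at_def by blast
  then show thesis using assms(2) by (intro that[of k]) auto
qed

lemma dyadic_PL_atI:
  assumes "\<forall>\<^sub>F y in nhds x. f y = f x + 2 powi k * (y - x)" "f x - 2 powi k * x \<in> dyadic"
  shows "dyadic_PL_at f x"
  unfolding dyadic_PL_at_def using assms by (intro exI[of _ k]) simp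

lemma dyadic_PL_at_reflect:
  assumes "dyadic_PL_at f x" shows "dyadic_PL_at (\<lambda>y. - f (- y)) (- x)"
proof -
  obtain k l where f1: "\<forall>\<^sub>F y in nhds x. f y = f x + (if y \<le> x then 2 powi k else 2 powi l) * (y - x)"
    and f2: "f x - 2 powi k * x \<in> dyadic" "f x - 2 powi l * x \<in> dyadic" "x \<notin> dyadic \<longrightarrow> k = l"
    using assms unfolding dyadic_PL_at_def by blast
  have dy: "- f x - 2 powi j * (- x) \<in> dyadic" if "f x - 2 powi j * x \<in> dyadic" for j :: int
    using dyadic_minus[OF that] by simp
  have "((\<lambda>y. - y) \<longlongrightarrow> x) (nhds (- x))"
    using tendsto_minus[OF filterlim_ident, of "- x"] by simp
  then have "\<forall>\<^sub>F y in nhds (- x). f (- y) = f x + (if - y \<le> x then 2 powi k else 2 powi l) * (- y - x)"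
    by (rule eventually_compose_filterlim[OF f1])
  then have "\<forall>\<^sub>F y in nhds (- x). - f (- y) = - f (- (- x)) + (if y \<le> - x then 2 powi l else 2 powi k) * (y - (- x))"
  proof eventually_elim
    case (elim y)
    then show ?case by (cases y "- x" rule: linorder_cases) (auto simp: algebra_simps)
  qed
  then show ?thesis unfolding dyadic_PL_at_def
    using dy[OF f2(1)] dy[OF f2(2)] f2(3) by (intro exI[of _ l] exI[of _ k]) auto
qed

section \<open>Thompson's group as restrictions of homeomorphisms of the line\<close>

abbreviation I01 :: "real set" where "I01 \<equiv> {0..1}"

lemma increasing_homeo_image_unit:
  assumes f: "increasing_homeo F" and 01: "F 0 = 0" "F 1 = 1"
  shows "F ` I01 = I01"
proof
  show "F ` I01 \<subseteq> I01"
    using increasing_homeo_le_iff[OF f, of 0] increasing_homeo_le_iff[OF f, of _ 1] 01 by auto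
  show "I01 \<subseteq> F ` I01"
  proof
    fix y assume "y \<in> I01"
    then have "inverse_map F y \<in> I01"
      using increasing_homeo_le_iff[OF f, of 0 "inverse_map F y"]
        increasing_homeo_le_iff[OF f, of "inverse_map F y" 1] 01 f by auto
    then show "y \<in> F ` I01" using f by (metis image_eqI increasing_homeo_f_inv)
  qed
qed

lemma inverse_unit:
  assumes "increasing_homeo F" "F 0 = 0" "F 1 = 1"
  shows "inverse_map F 0 = 0" "inverse_map F 1 = 1"
  using increasing_homeo_inv_f[OF assms(1), of 0] increasing_homeo_inv_f[OF assms(1), of 1] assms(2,3) by auto

lemma restrict_in_homeo_group:
  assumes f: "increasing_homeo F" and 01: "F 0 = 0" "F 1 = 1"
  shows "restrict F I01 \<in> carrier homeo_group"
proof -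
  have im: "F ` I01 = I01" "inverse_map F ` I01 = I01"
    using f 01 inverse_unit[OF assms]
    by (intro increasing_homeo_image_unit increasing_homeo_inv; simp)+
  have "bij_betw (restrict F I01) I01 I01"
    using im f by (auto simp: bij_betw_def inj_on_def increasing_homeo_eq_iff)
  moreover have "homeomorphism I01 I01 (restrict F I01) (inverse_map F)"
  proof (rule homeomorphismI)
    show "continuous_on I01 (restrict F I01)"
      by (rule continuous_on_eq[OF increasing_homeo_continuous[OF f]]) simp
    show "continuous_on I01 (inverse_map F)" using f by (intro increasing_homeo_continuous) auto
  qed (use im f in auto)
  ultimately show ?thesis
    unfolding homeo_group_def Bij_def by (simp del: restrict_apply) blast
qed

lemma affine_on_open_to_closed:
  assumes F: "increasing_homeo F" and ab: "a < b" and "\<forall>x\<in>{a<..<b}. F x = s * x + c"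
  shows "\<forall>x\<in>{a..b}. F x = s * x + c"
proof 
  have "closed {x. F x = s * x + c}"
    by (intro closed_Collect_eq continuous_intros increasing_homeo_continuous F)
  then have "closure {a<..<b} \<subseteq> {x. F x = s * x + c}" using assms(3) by (intro closure_minimal) auto
  moreover fix x assume "x \<in> {a..b}"
  ultimately show "F x = s * x + c" using ab by auto
qed

text \<open>The pair of slope exponent and additive constant of the germ is a locally constant function on the
interval, hence constant.\<close>
lemma locally_affine_imp_affine:
  fixes F :: "real \<Rightarrow> real"
  assumes "a < b" and loc: "\<And>x. a < x \<Longrightarrow> x < b \<Longrightarrow> \<exists>k::int. \<forall>\<^sub>F y in nhds x. F y = F x + 2 powi k * (y - x)"
  shows "\<exists>(k::int) c. \<forall>x\<in>{a<..<b}. F x = 2 powi k * x + c"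
proof -
  obtain K :: "real \<Rightarrow> int" where K: "\<And>x. a < x \<Longrightarrow> x < b \<Longrightarrow> \<forall>\<^sub>F y in nhds x. F y = F x + 2 powi K x * (y - x)"
    using loc by metis
  have uniq: "k = l" if "\<forall>\<^sub>F y in nhds x. F y = F x + 2 powi k * (y - x)"
    "\<forall>\<^sub>F y in nhds x. F y = F x + 2 powi l * (y - x)" for x and k l :: int
  proof -
    have "\<forall>\<^sub>F y in nhds x. 2 powi k * (y - x) = 2 powi l * (y - x)"
      using that by eventually_elim (metis add_left_cancel)
    then have "\<forall>\<^sub>F y in at x. 2 powi k * (y - x) = 2 powi l * (y - x) \<and> y \<noteq> x"
      unfolding eventually_at_filter by eventually_elim auto
    then obtain y where "2 powi k * (y - x) = 2 powi l * (y - x)" "y \<noteq> x"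
      using eventually_happens'[OF at_neq_bot] by blast
    then show ?thesis by (simp add: two_powi_inject)
  qed
  have shift: "\<forall>\<^sub>F z in nhds x. \<forall>\<^sub>F y in nhds z. F y = F z + 2 powi K x * (y - z)"
    if x: "a < x" "x < b" for x
  proof -
    have "\<forall>\<^sub>F z in nhds x. \<forall>\<^sub>F y in nhds z. F y = F x + 2 powi K x * (y - x)"
      using K[OF x] by (simp add: eventually_eventually)
    then show ?thesis
    proof eventually_elim
      case (elim z)
      have "F z = F x + 2 powi K x * (z - x)" using elim by (rule eventually_nhds_x_imp_x)
      with elim show ?case by (auto elim!: eventually_mono simp: algebra_simps)
    qed
  qed
  define h where "h x = (K x, F x - 2 powi K x * x)" for x
  have "h x = h y" if xy: "x \<in> {a<..<b}" "y \<in> {a<..<b}" for x y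
  proof (rule connected_local_const[OF _ xy], safe)
    fix x assume x: "x \<in> {a<..<b}"
    have ax: "a < x" "x < b" using x by auto
    have "\<forall>\<^sub>F z in nhds x. z \<in> {a<..<b}" using x by (intro eventually_nhds_in_open) auto
    then have "\<forall>\<^sub>F z in nhds x. h x = h z"
      using shift[OF ax] K[OF ax]
    proof eventually_elim
      case (elim z)
      have "K z = K x"
        by (rule uniq[OF K[of z] elim(2)]) (use elim(1) in auto)
      then show ?case using elim by (simp add: h_def algebra_simps)
    qed
    then show "\<forall>\<^sub>F z in at x within {a<..<b}. h x = h z"
      unfolding eventually_at_filter by eventually_elim simp
  qed auto
  moreover have mid: "(a + b) / 2 \<in> {a<..<b}" using assms(1) by auto
  ultimately have h_mid: "h y = h ((a + b) / 2)" if "y \<in> {a<..<b}" for y using that by blast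
  have "F y = 2 powi (fst (h y)) * y + snd (h y)" for y by (simp add: h_def)
  then have "\<forall>y\<in>{a<..<b}. F y = 2 powi (fst (h ((a + b) / 2))) * y + snd (h ((a + b) / 2))"
    using h_mid by metis
  then show ?thesis by blast
qed

text \<open>A point has a neighbourhood in which every other point is a point of linearity, and so is the point
itself unless it is dyadic. Compactness, in the form of the Bolzano bisection principle, then leaves a
finite set of dyadic candidates for break points.\<close>
lemma PL_homeos_restrict_in_thompson_F:
  assumes F: "F \<in> PL_homeos" and 01: "F 0 = 0" "F 1 = 1"
  shows "restrict F I01 \<in> thompson_F"
proof -
  have inc: "increasing_homeo F" and PL: "\<And>x. dyadic_PL_at F x" using F by (auto simp: PL_homeos_def)
  define lin where "lin x \<longleftrightarrow> (\<exists>k::int. \<forall>\<^sub>F y in nhds x. F y = F x + 2 powi k * (y - x))" for x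
  have lin_near: "\<forall>\<^sub>F z in nhds x. z = x \<and> x \<in> dyadic \<or> lin z" for x
  proof -
    obtain k l where kl: "\<forall>\<^sub>F y in nhds x. F y = F x + (if y \<le> x then 2 powi k else 2 powi l) * (y - x)" 
      "x \<notin> dyadic \<longrightarrow> k = l" using PL[of x] unfolding dyadic_PL_at_def by blast
    have "\<forall>\<^sub>F z in nhds x. \<forall>\<^sub>F y in nhds z. F y = F x + (if y \<le> x then 2 powi k else 2 powi l) * (y - x)"
      using kl by (simp add: eventually_eventually)
    then show ?thesis
    proof eventually_elim
      case (elim z)
      have z: "F z = F x + (if z \<le> x then 2 powi k else 2 powi l) * (z - x)"
        using elim by (rule eventually_nhds_x_imp_x)
      have "lin z" if "z < x"
      proof -
        have "\<forall>\<^sub>F y in nhds z. y \<in> {..<x}" using that by (intro eventually_nhds_in_open) auto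
        then have "\<forall>\<^sub>F y in nhds z. F y = F z + 2 powi k * (y - z)"
          using elim by eventually_elim (use z that in \<open>auto simp: algebra_simps\<close>)
        then show ?thesis unfolding lin_def by blast
      qed
      moreover have "lin z" if "z > x"
      proof -
        have "\<forall>\<^sub>F y in nhds z. y \<in> {x<..}" using that by (intro eventually_nhds_in_open) auto
        then have "\<forall>\<^sub>F y in nhds z. F y = F z + 2 powi l * (y - z)"
          using elim by eventually_elim (use z that in \<open>auto simp: algebra_simps\<close>)
        then show ?thesis unfolding lin_def by blast
      qed
      moreover have "lin z" if "z = x" "x \<notin> dyadic"
        using kl that unfolding lin_def by auto
      ultimately show ?case by (cases z x rule: linorder_cases) auto
    qed
  qed
  have "\<exists>B. finite B \<and> B \<subseteq> dyadic \<and> (\<forall>x\<in>{0..1}. x \<in> B \<or> lin x)"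
  proof (rule Bolzano[where a = 0 and b = 1 and
        P = "\<lambda>a b. \<exists>B. finite B \<and> B \<subseteq> dyadic \<and> (\<forall>x\<in>{a..b}. x \<in> B \<or> lin x)"])
    fix a b c :: real
    assume "\<exists>B. finite B \<and> B \<subseteq> dyadic \<and> (\<forall>x\<in>{a..b}. x \<in> B \<or> lin x)"
      "\<exists>B. finite B \<and> B \<subseteq> dyadic \<and> (\<forall>x\<in>{b..c}. x \<in> B \<or> lin x)"
    then obtain B1 B2 where "finite B1 \<and> B1 \<subseteq> dyadic \<and> (\<forall>x\<in>{a..b}. x \<in> B1 \<or> lin x)" 
       "finite B2 \<and> B2 \<subseteq> dyadic \<and> (\<forall>x\<in>{b..c}. x \<in> B2 \<or> lin x)" by blast
    then show "\<exists>B. finite B \<and> B \<subseteq> dyadic \<and> (\<forall>x\<in>{a..c}. x \<in> B \<or> lin x)"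
      by (intro exI[of _ "B1 \<union> B2"]) (metis UnCI Un_least atLeastAtMost_iff finite_UnI linear)
  next
    fix x :: real
    obtain e where e: "e > 0" "\<And>z. dist z x < e \<Longrightarrow> z = x \<and> x \<in> dyadic \<or> lin z"
      using lin_near[of x] unfolding eventually_nhds_metric by blast
    have "\<exists>B. finite B \<and> B \<subseteq> dyadic \<and> (\<forall>z\<in>{a..b}. z \<in> B \<or> lin z)" if ab: "a \<le> x \<and> x \<le> b \<and> b - a < e" for a b
    proof -
      have "z \<in> {x} \<inter> dyadic \<or> lin z" if "z \<in> {a..b}" for z
      proof -
        have "dist z x < e" using ab that unfolding dist_real_def atLeastAtMost_iff by linarith
        then show ?thesis using e(2)[of z] by blast
      qed
      then show ?thesis by (intro exI[of _ "{x} \<inter> dyadic"]) auto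
    qed
    then show "\<exists>d>0. \<forall>a b. a \<le> x \<and> x \<le> b \<and> b - a < d \<longrightarrow>
        (\<exists>B. finite B \<and> B \<subseteq> dyadic \<and> (\<forall>x\<in>{a..b}. x \<in> B \<or> lin x))"
      using e(1) by blast
  qed simp
  then obtain B where B: "finite B" "B \<subseteq> dyadic" "\<And>x. x \<in> {0..1} \<Longrightarrow> x \<in> B \<or> lin x" by blast
  have aff: "\<exists>(k::int) c. \<forall>x\<in>{a..b}. restrict F I01 x = 2 powi k * x + c"
    if ab: "0 \<le> a" "a < b" "b \<le> 1" "{a<..<b} \<inter> B = {}" for a b
  proof -
    have "\<exists>(k::int) c. \<forall>x\<in>{a<..<b}. F x = 2 powi k * x + c"
    proof (rule locally_affine_imp_affine[OF ab(2)])
      fix x assume "a < x" "x < b"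
      then have "lin x" using B(3)[of x] ab by force
      then show "\<exists>k::int. \<forall>\<^sub>F y in nhds x. F y = F x + 2 powi k * (y - x)" unfolding lin_def .
    qed
    then obtain k :: int and c where "\<forall>x\<in>{a<..<b}. F x = 2 powi k * x + c" by blast
    then have "\<forall>x\<in>{a..b}. F x = 2 powi k * x + c" by (rule affine_on_open_to_closed[OF inc ab(2)])
    then have "\<forall>x\<in>{a..b}. restrict F I01 x = 2 powi k * x + c" using ab by auto
    then show ?thesis by blast
  qed
  have sm: "strict_mono_on I01 (restrict F I01)"
    using inc by (auto simp: strict_mono_on_def increasing_homeo_less_iff)
  show ?thesis unfolding thompson_F_def
  proof (intro CollectI conjI exI[of _ B] allI impI)
    fix a b :: real assume "0 \<le> a \<and> a < b \<and> b \<le> 1 \<and> {a<..<b} \<inter> B = {}"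
    then show "\<exists>(k::int) c. \<forall>x\<in>{a..b}. restrict F I01 x = 2 powi k * x + c" using aff by blast
  qed (fact restrict_in_homeo_group[OF inc 01] sm B)+
qed

text \<open>The extension is the identity outside the unit interval. The definition of \<open>F\<close> prescribes
slopes but not the additive constants of the linear pieces. These are dyadic because \<open>f\<close> maps
dyadic points to dyadic points, which is proved from left to right along the break points, starting
at \<open>f 0 = 0\<close>.\<close>
lemma thompson_F_extends:
  assumes f: "f \<in> thompson_F"
  obtains F where "F \<in> PL_homeos" "F 0 = 0" "F 1 = 1" "f = restrict F I01"
proof -
  have "f \<in> carrier homeo_group" and mono: "strict_mono_on I01 f"
    using f unfolding thompson_F_def by blast+
  then have bij: "bij_betw f I01 I01" and ext: "f \<in> extensional I01"
    by (simp_all add: homeo_group_def Bij_def)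
  have "\<exists>B. finite B \<and> B \<subseteq> dyadic \<and>
      (\<forall>a b. 0 \<le> a \<and> a < b \<and> b \<le> 1 \<and> {a<..<b} \<inter> B = {} \<longrightarrow>
        (\<exists>(k::int) c. \<forall>x\<in>{a..b}. f x = 2 powi k * x + c))"
    using f unfolding thompson_F_def by (elim CollectE conjE)
  then obtain B where B: "finite B" "B \<subseteq> dyadic"
    and lin': "\<forall>a b. 0 \<le> a \<and> a < b \<and> b \<le> 1 \<and> {a<..<b} \<inter> B = {} \<longrightarrow>
        (\<exists>(k::int) c. \<forall>x\<in>{a..b}. f x = 2 powi k * x + c)"
    by (elim exE conjE)
  have lin: "\<exists>(k::int) c. \<forall>x\<in>{a..b}. f x = 2 powi k * x + c"
    if "0 \<le> a" "a < b" "b \<le> 1" "{a<..<b} \<inter> B = {}" for a b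
    using lin'[rule_format, of a b] that by simp
  have im: "f ` I01 = I01" using bij by (simp add: bij_betw_def)
  have le: "f x \<le> f y" if "0 \<le> x" "x \<le> y" "y \<le> 1" for x y
    using strict_mono_onD[OF mono, of x y] that by (cases "x = y") auto
  have "0 \<in> f ` I01" "1 \<in> f ` I01" unfolding im by auto
  then obtain x0 x1 where x01: "x0 \<in> I01" "f x0 = 0" "x1 \<in> I01" "f x1 = 1" by fastforce
  have f_in: "0 \<le> f x" "f x \<le> 1" if "0 \<le> x" "x \<le> 1" for x
  proof -
    have "f x \<in> f ` I01" using that by simp
    then show "0 \<le> f x" "f x \<le> 1" unfolding im by auto
  qed
  have f0: "f 0 = 0" using le[of 0 x0] x01 f_in(1)[of 0] by simp
  have f1: "f 1 = 1" using le[of x1 1] x01 f_in(2)[of 1] by simp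
  have dy: "f x \<in> dyadic" if "0 \<le> x" "x \<le> 1" "x \<in> dyadic" for x
    using that
  proof (induction "card (B \<inter> {0<..<x})" arbitrary: x rule: less_induct)
    case less
    have fin: "finite (B \<inter> {0<..<x})" using B by simp
    define b where "b = (if B \<inter> {0<..<x} = {} then 0 else Max (B \<inter> {0<..<x}))"
    show ?case
    proof (cases "x = 0")
      case False
      have b: "0 \<le> b" "b < x" "{b<..<x} \<inter> B = {}" "b \<in> dyadic \<and> f b \<in> dyadic"
      proof -
        have *: "b \<in> B \<inter> {0<..<x}" if "B \<inter> {0<..<x} \<noteq> {}"
          using Max_in[OF fin that] that by (simp add: b_def)
        show "0 \<le> b" "b < x" using * False less.prems by (fastforce simp: b_def)+
        show "{b<..<x} \<inter> B = {}"
          using Max_ge[OF fin] \<open>0 \<le> b\<close> by (fastforce simp: b_def split: if_splits)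
        show "b \<in> dyadic \<and> f b \<in> dyadic"
        proof (cases "B \<inter> {0<..<x} = {}")
          case True
          then show ?thesis by (simp add: b_def f0)
        next
          case nonempty: False
          have "B \<inter> {0<..<b} \<subset> B \<inter> {0<..<x}" using *[OF nonempty] by auto
          then have "card (B \<inter> {0<..<b}) < card (B \<inter> {0<..<x})" using fin by (rule psubset_card_mono[rotated])
          then show ?thesis using less.hyps[of b] *[OF nonempty] B(2) less.prems by auto
        qed
      qed
      obtain k :: int and c where kc: "\<forall>y\<in>{b..x}. f y = 2 powi k * y + c"
        using lin[of b x] b less.prems by auto
      have "f x = f b + 2 powi k * (x - b)" using kc b by (auto simp: algebra_simps)
      then show ?thesis using b less.prems by simp
    qed (simp add: f0)
  qed
  define F where "F x = (if x \<in> I01 then f x else x)" for x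
  have F01: "F 0 = 0" "F 1 = 1" by (simp_all add: F_def f0 f1)
  have "increasing_homeo F" unfolding increasing_homeo_def
  proof
    show "strict_mono F"
    proof (rule strict_monoI)
      fix x y :: real assume "x < y"
      then show "F x < F y"
        using strict_mono_onD[OF mono, of x y] f_in[of x] f_in[of y] by (auto simp: F_def)
    qed
    show "surj F"
    proof -
      have "\<exists>x. F x = y" for y
      proof (cases "y \<in> I01")
        case True
        then obtain x where "x \<in> I01" "f x = y" using im by (metis imageE)
        then show ?thesis by (intro exI[of _ x]) (simp add: F_def)
      qed (auto simp: F_def)
      then show ?thesis unfolding surj_def by metis
    qed
  qed
  moreover have "dyadic_PL_at F x" for x
  proof -
    have right: "\<exists>(k::int) e. e > 0 \<and> (\<forall>y\<in>{x..x+e}. F y = F x + 2 powi k * (y - x)) \<and>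
        F x - 2 powi k * x \<in> dyadic" 
    proof -
      consider "x < 0" | "x \<ge> 1" | "0 \<le> x" "x < 1" by linarith
      then show ?thesis
      proof cases
        case 1
        then show ?thesis by (intro exI[of _ 0] exI[of _ "- x / 2"]) (auto simp: F_def)
      next
        case 2
        then show ?thesis by (intro exI[of _ 0] exI[of _ 1]) (auto simp: F_def f1)
      next
        case 3
        have "finite (insert 1 (B \<inter> {x<..}))" using B by simp
        define b where "b = Min (insert 1 (B \<inter> {x<..}))"
        have b: "x < b" "b \<le> 1" using B 3 by (auto simp: b_def)
        have "{x<..<b} \<inter> B = {}" using B Min_le[OF \<open>finite (insert 1 (B \<inter> {x<..}))\<close>] by (force simp: b_def)
        then obtain k :: int and c where kc: "\<forall>y\<in>{x..b}. f y = 2 powi k * y + c"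
          using lin[of x b] b 3 by auto
        obtain z where z: "z \<in> dyadic" "x < z" "z < b" using dyadic_between b(1) by blast
        have "f z \<in> dyadic" using dy[of z] z b 3 by auto
        moreover have "F x - 2 powi k * x = f z - 2 powi k * z" using kc z b 3 by (simp add: F_def)
        ultimately have "F x - 2 powi k * x \<in> dyadic" using z by simp
        then show ?thesis using b 3 kc
          by (intro exI[of _ k] exI[of _ "b - x"]) (auto simp: F_def algebra_simps)
      qed
    qed
    have left: "\<exists>(k::int) e. e > 0 \<and> (\<forall>y\<in>{x-e..x}. F y = F x + 2 powi k * (y - x)) \<and>
        F x - 2 powi k * x \<in> dyadic"
    proof -
      consider "x \<le> 0" | "x > 1" | "0 < x" "x \<le> 1" by linarith
      then show ?thesis
      proof cases
        case 1
        then show ?thesis by (intro exI[of _ 0] exI[of _ 1]) (auto simp: F_def f0)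
      next
        case 2
        then show ?thesis by (intro exI[of _ 0] exI[of _ "(x - 1) / 2"]) (auto simp: F_def field_simps)
      next
        case 3
        have fin: "finite (insert 0 (B \<inter> {..<x}))" using B by simp
        define b where "b = Max (insert 0 (B \<inter> {..<x}))"
        have b: "b < x" "0 \<le> b" using B 3 by (auto simp: b_def)
        have "{b<..<x} \<inter> B = {}" using B Max_ge[OF fin] by (force simp: b_def)
        then obtain k :: int and c where kc: "\<forall>y\<in>{b..x}. f y = 2 powi k * y + c"
          using lin[of b x] b 3 by auto
        obtain z where z: "z \<in> dyadic" "b < z" "z < x" using dyadic_between b(1) by blast
        have "f z \<in> dyadic" using dy[of z] z b 3 by auto
        moreover have "F x - 2 powi k * x = f z - 2 powi k * z" using kc z b 3 by (simp add: F_def)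
        ultimately have "F x - 2 powi k * x \<in> dyadic" using z by simp
        then show ?thesis using b 3 kc
          by (intro exI[of _ k] exI[of _ "x - b"]) (auto simp: F_def algebra_simps)
      qed
    qed
    obtain l and e where r: "e > 0" "\<forall>y\<in>{x..x+e}. F y = F x + 2 powi (l::int) * (y - x)" "F x - 2 powi l * x \<in> dyadic" 
      using right by blast
    obtain k and e' where l: "e' > 0" "\<forall>y\<in>{x-e'..x}. F y = F x + 2 powi (k::int) * (y - x)" "F x - 2 powi k * x \<in> dyadic" 
      using left by blast
    have ev: "\<forall>\<^sub>F y in nhds x. y \<in> {x-e'<..<x+e}" using r(1) l(1) by (intro eventually_nhds_in_open) auto
    have "k = l" if "x \<notin> dyadic"
    proof -
      \<comment> \<open>Near a nondyadic point the map is linear, so both one-sided slopes agree with its slope.\<close>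
      have "\<exists>k::int. \<forall>\<^sub>F y in nhds x. F y = F x + 2 powi k * (y - x)"
      proof (cases "x \<in> I01")
        case True
        then have x: "0 < x" "x < 1" using that by (auto simp: order_less_le)
        have fin: "finite (B - {x})" using B by simp
        have "open ({0<..<1} - B)" using B(1) by (intro open_Diff finite_imp_closed) auto
        moreover have "x \<in> {0<..<1} - B" using x B that by auto
        ultimately obtain e where e: "e > 0" "ball x e \<subseteq> {0<..<1} - B" by (meson open_contains_ball)
        have "x - e/2 \<in> ball x e" "x + e/2 \<in> ball x e" using e(1) by (auto simp: dist_real_def)
        then have "x - e/2 \<in> {0<..<1}" "x + e/2 \<in> {0<..<1}" using e(2) by blast+
        then have "0 \<le> x - e/2" "x + e/2 \<le> 1" by auto
        moreover have "{x-e/2<..<x+e/2} \<inter> B = {}" using e by (auto simp: ball_def dist_real_def subset_iff)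
        ultimately obtain k :: int and c where kc: "\<forall>y\<in>{x-e/2..x+e/2}. f y = 2 powi k * y + c"
          using lin[of "x-e/2" "x+e/2"] e by auto
        have "\<forall>\<^sub>F y in nhds x. y \<in> {x-e/2<..<x+e/2}" using e(1) by (intro eventually_nhds_in_open) auto
        then have "\<forall>\<^sub>F y in nhds x. F y = F x + 2 powi k * (y - x)"
        proof eventually_elim
          case (elim y)
          then have "F y = f y" "F x = f x" using \<open>0 \<le> x - e/2\<close> \<open>x + e/2 \<le> 1\<close> by (auto simp: F_def)
          then show ?case using kc elim e(1) by (simp add: algebra_simps)
        qed
        then show ?thesis by blast
      next
        case False
        then have "x \<in> - I01" by auto
        then have "\<forall>\<^sub>F y in nhds x. y \<in> - I01" by (intro eventually_nhds_in_open) auto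
        then have "\<forall>\<^sub>F y in nhds x. F y = F x + 2 powi 0 * (y - x)"
          using False by (auto elim!: eventually_mono simp: F_def)
        then show ?thesis by blast
      qed
      then obtain j :: int where "\<forall>\<^sub>F y in nhds x. F y = F x + 2 powi j * (y - x)" by blast
      then obtain d where d: "d > 0" "\<And>y. dist y x < d \<Longrightarrow> F y = F x + 2 powi j * (y - x)"
        unfolding eventually_nhds_metric by blast
      define t where "t = min (d/2) (min e e')"
      have t: "t > 0" "t < d" "t \<le> e" "t \<le> e'" using d(1) r(1) l(1) by (auto simp: t_def)
      have "F (x + t) = F x + 2 powi j * t" "F (x - t) = F x + 2 powi j * (- t)"
        using d(2)[of "x + t"] d(2)[of "x - t"] t by (simp_all add: dist_real_def)
      moreover have "F (x + t) = F x + 2 powi l * t" using r(2)[rule_format, of "x + t"] t by simp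
      moreover have "F (x - t) = F x + 2 powi k * (- t)" using l(2)[rule_format, of "x - t"] t by simp
      ultimately have "(2::real) powi k = 2 powi l" using t(1) by simp
      then show "k = l" by (simp only: two_powi_inject)
    qed
    moreover have "\<forall>\<^sub>F y in nhds x. F y = F x + (if y \<le> x then 2 powi k else 2 powi l) * (y - x)"
      using ev
    proof eventually_elim
      case (elim y)
      then show ?case using l(2)[rule_format, of y] r(2)[rule_format, of y] by simp
    qed
    ultimately show ?thesis unfolding dyadic_PL_at_def using l(3) r(3) by blast
  qed
  ultimately have "F \<in> PL_homeos" unfolding PL_homeos_def by blast
  moreover have "f = restrict F I01"
    using ext by (auto simp: F_def restrict_def extensional_def)
  ultimately show thesis using that F01 by blast
qed

section \<open>Slopes at a fixed point\<close>

text \<open>If \<open>f\<close> is given near its fixed point \<open>x\<close> by \<open>y \<mapsto> 2\<^sup>k y + c\<close> with dyadic \<open>c\<close>, then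
\<open>(2\<^sup>k - 1) x = - c\<close> is dyadic. The possible \<open>k\<close> form the subgroup of \<open>\<int>\<close> generated by \<open>p\<close>. For
rational nondyadic \<open>x\<close>, \<open>p\<close> is the length of the period of the binary expansion of \<open>x\<close>.\<close>
definition period_generator :: "real \<Rightarrow> int \<Rightarrow> bool" where
  "period_generator x p \<longleftrightarrow> 0 \<le> p \<and> (\<forall>k. (2 powi k - 1) * x \<in> dyadic \<longleftrightarrow> p dvd k)"

lemma period_generator_self: "period_generator x p \<Longrightarrow> (2 powi p - 1) * x \<in> dyadic"
  unfolding period_generator_def by (elim conjE allE[of _ p]) simp

lemma period_generator_irrational:
  assumes "x \<notin> \<rat>" shows "period_generator x 0"
proof -
  have "k = 0" if k: "(2 powi k - 1) * x \<in> dyadic" for k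
  proof (rule ccontr)
    assume "k \<noteq> 0"
    moreover have "(2 powi k - 1 :: real) \<in> \<rat>" "(2 powi k - 1) * x \<in> \<rat>"
      using dyadic_subset_Rats k by auto
    ultimately show False
      using assms two_powi_inject[of k 0] Rats_divide[of "(2 powi k - 1) * x" "2 powi k - 1"] by simp
  qed
  then show ?thesis unfolding period_generator_def by auto
qed

text \<open>By the pigeonhole principle two of the residues \<open>2\<^sup>i a mod b\<close> agree when \<open>x = a / b\<close>, so some
\<open>(2\<^sup>j - 2\<^sup>i) x\<close> with \<open>i < j\<close> is an integer.\<close>
lemma rational_period_exists:
  assumes "x \<in> \<rat>" shows "\<exists>n>0. (2 ^ n - 1) * x \<in> dyadic"
proof -
  obtain a b where ab: "b > 0" "x = of_int a / of_int b" by (rule Rats_cases'[OF assms])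
  have "(\<lambda>i::nat. (2 ^ i * a) mod b) ` UNIV \<subseteq> {0..<b}" using ab by auto
  then have "\<not> inj (\<lambda>i::nat. (2 ^ i * a) mod b)"
    using finite_imageD[of "\<lambda>i::nat. (2 ^ i * a) mod b" UNIV] finite_subset infinite_UNIV_nat by blast
  then obtain i j :: nat where ij: "i < j" "(2 ^ i * a) mod b = (2 ^ j * a) mod b"
    unfolding inj_def by (metis linorder_neqE_nat)
  then have "b dvd 2 ^ j * a - 2 ^ i * a" by (metis mod_eq_dvd_iff)
  then obtain m where m: "2 ^ j * a - 2 ^ i * a = b * m" by blast
  have "(2 ^ j - 2 ^ i) * x = of_int (2 ^ j * a - 2 ^ i * a) / of_int b" using ab by (simp add: algebra_simps diff_divide_distrib)
  also have "\<dots> = of_int m" unfolding m using ab by simp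
  finally have "(2 ^ j - 2 ^ i) * x = of_int m" .
  moreover have "2 powi (int i) * ((2 ^ (j - i) - 1) * x) = (2 ^ j - 2 ^ i) * x"
    using ij(1) by (simp add: algebra_simps flip: power_add)
  ultimately have "2 powi (int i) * ((2 ^ (j - i) - 1) * x) \<in> dyadic" by simp
  then have "(2 ^ (j - i) - 1) * x \<in> dyadic" by (simp only: dyadic_powi_mult_iff)
  then show ?thesis using ij(1) by (intro exI[of _ "j - i"]) auto
qed

text \<open>The generator is the least positive exponent; division with remainder shows that it divides all
others.\<close>
lemma period_generator_rational:
  assumes "x \<in> \<rat>" obtains p where "p > 0" "period_generator x p"
proof -
  define P where "P k \<longleftrightarrow> (2 powi k - 1) * x \<in> dyadic" for k :: int
  have add: "P (k + l)" if "P k" "P l" for k l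
  proof -
    have "(2 powi (k + l) - 1) * x = 2 powi k * ((2 powi l - 1) * x) + (2 powi k - 1) * x"
      by (simp add: power_int_add algebra_simps)
    then show ?thesis using that unfolding P_def by (metis dyadic_add dyadic_powi_mult_iff)
  qed
  have minus: "P (- k)" if "P k" for k
  proof -
    have "2 powi k * ((2 powi (- k) - 1) * x) = - ((2 powi k - 1) * x)"
      by (simp add: power_int_minus algebra_simps)
    then show ?thesis using that unfolding P_def by (metis dyadic_minus dyadic_powi_mult_iff)
  qed
  have ex: "\<exists>n>0. P (int n)" using rational_period_exists[OF assms] by (simp add: P_def)
  define p where "p = (LEAST n. n > 0 \<and> P (int n))"
  have p: "p > 0" "P (int p)" using LeastI_ex[OF ex] unfolding p_def by auto
  have least: "p \<le> n" if "n > 0" "P (int n)" for n using that unfolding p_def by (intro Least_le) auto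
  have nmult: "P (int p * int l)" for l :: nat
    by (induction l) (auto simp: algebra_simps add p, simp add: P_def)
  have mult: "P (int p * l)" for l
    using nmult[of "nat l"] minus[OF nmult[of "nat (- l)"]] by (cases "l \<ge> 0") auto
  have "int p dvd k" if "P k" for k
  proof (rule ccontr)
    assume nd: "\<not> int p dvd k"
    have eq: "k + int p * (- (k div int p)) = k mod int p"
      by (simp add: minus_mult_div_eq_mod)
    have "P (k mod int p)" using add[OF that mult[of "- (k div int p)"]] unfolding eq .
    moreover have "k mod int p > 0"
      using nd p(1) pos_mod_sign[of "int p" k] mod_eq_0_iff_dvd[of k "int p"] by linarith
    ultimately have "int p \<le> k mod int p" using least[of "nat (k mod int p)"] by auto
    then show False using p(1) pos_mod_bound[of "int p" k] by linarith
  qed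
  then have "period_generator x (int p)"
    unfolding period_generator_def P_def[symmetric] using mult by (auto simp: dvd_def)
  then show thesis using that[of "int p"] p by simp
qed

text \<open>The dilation with centre \<open>x\<close> and factor \<open>2\<^sup>k\<close>.\<close>
definition dil :: "real \<Rightarrow> int \<Rightarrow> real \<Rightarrow> real" where
  "dil x k u = x + 2 powi k * (u - x)"

lemma dil_dil [simp]: "dil x k (dil x l u) = dil x (k + l) u"
  unfolding dil_def by (simp add: power_int_add algebra_simps)

lemma dil_0 [simp]: "dil x 0 u = u" and dil_centre [simp]: "dil x k x = x"
  unfolding dil_def by simp_all

lemma dil_less_iff [simp]: "dil x k u < dil x k v \<longleftrightarrow> u < v"
  and dil_le_iff [simp]: "dil x k u \<le> dil x k v \<longleftrightarrow> u \<le> v"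
  unfolding dil_def by simp_all

lemma dil_greater_centre [simp]: "x < dil x k u \<longleftrightarrow> x < u"
  and dil_less_centre [simp]: "dil x k u < x \<longleftrightarrow> u < x"
  using dil_less_iff[of x k x u] dil_less_iff[of x k u x] by auto

lemma dil_minus: "dil (- x) k (- u) = - dil x k u"
  unfolding dil_def by (simp add: algebra_simps)

lemma dil_PL_homeo:
  assumes "(2 powi k - 1) * x \<in> dyadic" shows "dil x k \<in> PL_homeos"
proof -
  have "dil x k = (\<lambda>y. 2 powi k * y + - ((2 powi k - 1) * x))"
    unfolding dil_def by (auto simp: algebra_simps)
  moreover have "(\<lambda>y. 2 powi k * y + - ((2 powi k - 1) * x)) \<in> PL_homeos"
    using assms by (intro PL_homeos_affine) (simp only: dyadic_minus)
  ultimately show ?thesis by simp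
qed

lemma dyadic_shift_minus:
  assumes "(2 powi k - 1) * x \<in> dyadic" shows "(2 powi (- k) - 1) * x \<in> dyadic"
proof -
  have "2 powi k * ((2 powi (- k) - 1) * x) = - ((2 powi k - 1) * x)"
    by (simp add: power_int_minus algebra_simps)
  then show ?thesis using assms by (metis dyadic_minus dyadic_powi_mult_iff)
qed

lemma dil_eventually:
  assumes "\<forall>\<^sub>F y in nhds x. P y" shows "\<forall>\<^sub>F y in nhds x. P (dil x k y)"
proof -
  have "dil x k = (\<lambda>y. 2 powi k * y + (x - 2 powi k * x))"
    by (auto simp: dil_def algebra_simps)
  then have "increasing_homeo (dil x k)" by (simp only: increasing_homeo_affine zero_less_power_int zero_less_numeral)
  then show ?thesis using increasing_homeo_eventually[of "dil x k" P x] assms by simp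
qed

section \<open>Interpolation between dyadic points\<close>

text \<open>Any two dyadic intervals are related by a piecewise linear map of the required kind. For \<open>[0,1]\<close> and
\<open>[0,n+1]\<close>: stretch \<open>[0,1]\<close> to \<open>[0,2]\<close>, map the first half to \<open>[0,n]\<close> by induction, and translate
the second half to \<open>[n,n+1]\<close>.\<close>
lemma interpolation_unit:
  assumes "n > 0" shows "\<exists>f\<in>PL_homeos. f 0 = 0 \<and> f 1 = of_nat n"
  using assms
proof (induction n rule: nat_induct_non_zero)
  case 1
  then show ?case using PL_homeos_translation[of 0] by (intro bexI[of _ "\<lambda>y. y"]) auto
next
  case (Suc n)
  then obtain f where f: "f \<in> PL_homeos" "f 0 = 0" "f 1 = of_nat n" by blast
  define g where "g = glue 1 f (\<lambda>y. y + (of_nat n - 1))"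
  have "g \<in> PL_homeos" unfolding g_def
    using f by (intro PL_homeos_glue PL_homeos_translation) auto
  then have "g \<circ> (\<lambda>y. 2 powi 1 * y + 0) \<in> PL_homeos"
    by (intro PL_homeos_comp PL_homeos_affine) auto
  moreover have "g 0 = 0" "g 2 = of_nat (Suc n)" using f by (auto simp: g_def glue_def)
  ultimately show ?case by (intro bexI[of _ "g \<circ> (\<lambda>y. 2 powi 1 * y + 0)"]) auto
qed

lemma interpolation_from_unit:
  assumes "a \<in> dyadic" "b \<in> dyadic" "a < b"
  obtains f where "f \<in> PL_homeos" "f 0 = a" "f 1 = b"
proof -
  have "b - a \<in> dyadic" using assms by simp
  then obtain m :: int and s :: nat where ms: "b - a = of_int m / 2 ^ s" unfolding dyadic_def by blast
  then have "m > 0" using assms(3) by (smt (verit) divide_nonpos_pos of_int_0_le_iff of_int_le_0_iff zero_less_power)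
  then obtain f where f: "f \<in> PL_homeos" "f 0 = 0" "f 1 = of_nat (nat m)"
    using interpolation_unit[of "nat m"] by auto
  have "(\<lambda>y. 2 powi (- int s) * y + a) \<circ> f \<in> PL_homeos"
    using assms f by (intro PL_homeos_comp PL_homeos_affine) auto
  then show thesis
    by (rule that[of "(\<lambda>y. 2 powi (- int s) * y + a) \<circ> f"])
      (use f ms \<open>m > 0\<close> in \<open>auto simp: power_int_minus field_simps\<close>)
qed

lemma interpolation:
  assumes "a \<in> dyadic" "b \<in> dyadic" "a < b" "c \<in> dyadic" "d \<in> dyadic" "c < d"
  obtains f where "f \<in> PL_homeos" "f a = c" "f b = d"
proof -
  obtain g where g: "g \<in> PL_homeos" "g 0 = a" "g 1 = b" using interpolation_from_unit assms by blast
  obtain h where h: "h \<in> PL_homeos" "h 0 = c" "h 1 = d" using interpolation_from_unit assms by blast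
  have "inverse_map g a = 0" "inverse_map g b = 1"
    using g increasing_homeo_inv_f[of g] unfolding PL_homeos_def by auto
  then show thesis
    using g h by (intro that[of "h \<circ> inverse_map g"] PL_homeos_comp PL_homeos_inv) auto
qed

text \<open>For \<open>p > 0\<close> the sequence is the orbit of \<open>b\<close> under the dilation by \<open>2\<^bsup>-p\<^esup>\<close>, which preserves
dyadicity since \<open>(2\<^sup>p - 1) \<gamma>\<close> is dyadic. For \<open>p = 0\<close> only convergence to \<open>\<gamma>\<close> matters. In both
cases the distance to \<open>\<gamma>\<close> is at least halved in each step.\<close>
lemma dyadic_sequence_to:
  assumes "\<gamma> < b" "b \<in> dyadic" "0 \<le> p" "(2 powi p - 1) * \<gamma> \<in> dyadic"
  shows "\<exists>a :: nat \<Rightarrow> real. a 0 = b \<and> (\<forall>n. a n \<in> dyadic) \<and> (\<forall>n. \<gamma> < a n) \<and> (\<forall>n. a (Suc n) < a n) \<and>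
    (\<forall>x>\<gamma>. \<exists>n. a n < x) \<and> (\<forall>n. p > 0 \<longrightarrow> a (Suc n) = dil \<gamma> (- p) (a n))"
proof -
  have step: "\<exists>z. (z \<in> dyadic \<and> \<gamma> < z) \<and> (z - \<gamma> \<le> (y - \<gamma>) / 2 \<and> (p > 0 \<longrightarrow> z = dil \<gamma> (- p) y))"
    if y: "y \<in> dyadic \<and> \<gamma> < y" for y
  proof (cases "p > 0")
    case True
    have "dil \<gamma> (- p) \<in> PL_homeos" using dyadic_shift_minus[OF assms(4)] by (rule dil_PL_homeo)
    then have "dil \<gamma> (- p) y \<in> dyadic"
      using y dyadic_PL_at_dyadic_iff unfolding PL_homeos_def by blast
    moreover have "(2::real) powi (- p) \<le> 2 powi (- 1)" using True by (intro power_int_increasing) auto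
    then have "2 powi (- p) * (y - \<gamma>) \<le> 1 / 2 * (y - \<gamma>)" using y by (intro mult_right_mono) auto
    then have "dil \<gamma> (- p) y - \<gamma> \<le> (y - \<gamma>) / 2" by (simp add: dil_def)
    ultimately show ?thesis using y True by (intro exI[of _ "dil \<gamma> (- p) y"]) auto
  next
    case False
    obtain z where "z \<in> dyadic" "\<gamma> < z" "z < \<gamma> + (y - \<gamma>) / 2"
      using dyadic_between[of \<gamma> "\<gamma> + (y - \<gamma>) / 2"] y by auto
    moreover from this have "z - \<gamma> \<le> (y - \<gamma>) / 2" by linarith
    ultimately show ?thesis using False by blast
  qed
  have "\<exists>a. \<forall>n. ((n = 0 \<longrightarrow> a n = b) \<and> a n \<in> dyadic \<and> \<gamma> < a n) \<and>
      (a (Suc n) - \<gamma> \<le> (a n - \<gamma>) / 2 \<and> (p > 0 \<longrightarrow> a (Suc n) = dil \<gamma> (- p) (a n)))"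
  proof (rule dependent_nat_choice)
    show "\<exists>x. (0 = (0::nat) \<longrightarrow> x = b) \<and> x \<in> dyadic \<and> \<gamma> < x" using assms by blast
  next
    fix y and n :: nat
    assume "(n = 0 \<longrightarrow> y = b) \<and> y \<in> dyadic \<and> \<gamma> < y"
    then show "\<exists>z. ((Suc n = 0 \<longrightarrow> z = b) \<and> z \<in> dyadic \<and> \<gamma> < z) \<and>
        z - \<gamma> \<le> (y - \<gamma>) / 2 \<and> (p > 0 \<longrightarrow> z = dil \<gamma> (- p) y)"
      using step[of y] by blast
  qed
  then obtain a where a: "a 0 = b" "\<And>n. a n \<in> dyadic" "\<And>n. \<gamma> < a n"
    "\<And>n. a (Suc n) - \<gamma> \<le> (a n - \<gamma>) / 2" "\<And>n. p > 0 \<Longrightarrow> a (Suc n) = dil \<gamma> (- p) (a n)" by blast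
  have geo: "a n - \<gamma> \<le> (b - \<gamma>) / 2 ^ n" for n
  proof (induction n)
    case (Suc n)
    have "a (Suc n) - \<gamma> \<le> (a n - \<gamma>) / 2" by (rule a)
    also have "\<dots> \<le> ((b - \<gamma>) / 2 ^ n) / 2" using Suc by (intro divide_right_mono) auto
    finally show ?case by (simp add: field_simps)
  qed (use a in auto)
  have "\<exists>n. a n < x" if "\<gamma> < x" for x
  proof -
    obtain n where "(1/2) ^ n < (x - \<gamma>) / (b - \<gamma>)"
      using real_arch_pow_inv[of "(x - \<gamma>) / (b - \<gamma>)" "1/2"] \<open>\<gamma> < x\<close> assms(1) by auto
    then have "(b - \<gamma>) / 2 ^ n < x - \<gamma>" using assms(1) by (simp add: field_simps power_one_over)
    then show ?thesis using geo[of n] by (intro exI[of _ n]) linarith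
  qed
  moreover have "a (Suc n) < a n" for n using a(3,4)[of n] by argo
  ultimately show ?thesis using a by blast
qed

text \<open>Here \<open>p = p' = 0\<close> serves irrational \<open>\<gamma>\<close> and \<open>\<delta>\<close>, where the equivariance is trivial. Take dyadic
sequences \<open>u\<close> and \<open>v\<close> decreasing to \<open>\<gamma>\<close> and \<open>\<delta>\<close> and maps \<open>h n\<close> taking \<open>[u\<^sub>n\<^sub>+\<^sub>1, u\<^sub>n]\<close> to
\<open>[v\<^sub>n\<^sub>+\<^sub>1, v\<^sub>n]\<close>. For \<open>p > 0\<close> the interval \<open>[u\<^sub>1, u\<^sub>0]\<close> is a fundamental domain of the dilation, and
\<open>h (n + 1)\<close> is the conjugate of \<open>h n\<close> by the two dilations. Gluing \<open>h 0, \<dots>, h n\<close> gives an element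
\<open>Gs n\<close> of \<open>PL_homeos\<close>, and \<open>G\<close> is the limit of these maps, which are eventually constant on every
interval \<open>[u\<^sub>n, \<infinity>)\<close>.\<close>
lemma half_line_homeo:
  assumes b: "\<gamma> < b" "b \<in> dyadic" and d: "\<delta> < d" "d \<in> dyadic"
    and p: "p = 0 \<and> p' = 0 \<or> 0 < p \<and> 0 < p'"
    and per: "(2 powi p - 1) * \<gamma> \<in> dyadic" "(2 powi p' - 1) * \<delta> \<in> dyadic"
  shows "\<exists>G. (\<forall>x>\<gamma>. \<forall>y>x. G x < G y) \<and> (\<forall>x>\<gamma>. \<delta> < G x) \<and> (\<forall>y>\<delta>. \<exists>x>\<gamma>. G x = y) \<and>
    (\<forall>x>\<gamma>. dyadic_PL_at G x) \<and> G b = d \<and>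
    (\<forall>x. \<gamma> < x \<longrightarrow> x \<le> b \<longrightarrow> G (dil \<gamma> (- p) x) = dil \<delta> (- p') (G x))"
proof -
  have p0: "0 \<le> p" "0 \<le> p'" "p > 0 \<longleftrightarrow> p' > 0" using p by auto
  obtain u :: "nat \<Rightarrow> real" where u: "u 0 = b" "\<And>n. u n \<in> dyadic" "\<And>n. \<gamma> < u n" "\<And>n. u (Suc n) < u n"
    "\<And>x. \<gamma> < x \<Longrightarrow> \<exists>n. u n < x" "\<And>n. p > 0 \<Longrightarrow> u (Suc n) = dil \<gamma> (- p) (u n)"
    using dyadic_sequence_to[OF b p0(1) per(1)] by blast
  obtain v :: "nat \<Rightarrow> real" where v: "v 0 = d" "\<And>n. v n \<in> dyadic" "\<And>n. \<delta> < v n" "\<And>n. v (Suc n) < v n"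
    "\<And>x. \<delta> < x \<Longrightarrow> \<exists>n. v n < x" "\<And>n. p' > 0 \<Longrightarrow> v (Suc n) = dil \<delta> (- p') (v n)"
    using dyadic_sequence_to[OF d p0(2) per(2)] by blast
  have piece: "\<exists>f\<in>PL_homeos. f (u n) = v n \<and> f (u (Suc n)) = v (Suc n)" for n
    using interpolation[OF u(2) u(2) u(4) v(2) v(2) v(4)] by blast
  have "\<exists>h. \<forall>n. (h n \<in> PL_homeos \<and> h n (u n) = v n \<and> h n (u (Suc n)) = v (Suc n)) \<and>
      (p > 0 \<longrightarrow> (\<forall>x. h (Suc n) (dil \<gamma> (- p) x) = dil \<delta> (- p') (h n x)))"
  proof (rule dependent_nat_choice)
    fix h n assume h: "h \<in> PL_homeos \<and> h (u n) = v n \<and> h (u (Suc n)) = v (Suc n)"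
    show "\<exists>h'. (h' \<in> PL_homeos \<and> h' (u (Suc n)) = v (Suc n) \<and> h' (u (Suc (Suc n))) = v (Suc (Suc n))) \<and>
        (p > 0 \<longrightarrow> (\<forall>x. h' (dil \<gamma> (- p) x) = dil \<delta> (- p') (h x)))"
    proof (cases "p > 0")
      case True
      define h' where "h' = dil \<delta> (- p') \<circ> (h \<circ> dil \<gamma> p)"
      have "h' \<in> PL_homeos" unfolding h'_def
        using h per dyadic_shift_minus[OF per(2)] by (intro PL_homeos_comp dil_PL_homeo) auto
      moreover have "h' (dil \<gamma> (- p) x) = dil \<delta> (- p') (h x)" for x by (simp add: h'_def)
      moreover have "h' (u (Suc m)) = v (Suc m)" if "h (u m) = v m" for m
        unfolding u(6)[OF True] v(6)[OF p0(3)[THEN iffD1, OF True]] using that by (simp add: h'_def)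
      ultimately show ?thesis using h by blast
    qed (use piece[of "Suc n"] in auto)
  qed (use piece[of 0] in auto)
  then obtain h where h: "\<And>n. h n \<in> PL_homeos" "\<And>n. h n (u n) = v n" "\<And>n. h n (u (Suc n)) = v (Suc n)"
    and h_eq: "\<And>n x. p > 0 \<Longrightarrow> h (Suc n) (dil \<gamma> (- p) x) = dil \<delta> (- p') (h n x)" by blast
  define Gs where "Gs = rec_nat (h 0) (\<lambda>n g. glue (u (Suc n)) (h (Suc n)) g)"
  have Gs_0: "Gs 0 = h 0" and Gs_Suc: "\<And>n. Gs (Suc n) = glue (u (Suc n)) (h (Suc n)) (Gs n)"
    by (simp_all add: Gs_def)
  have Gs: "Gs n \<in> PL_homeos \<and> Gs n (u (Suc n)) = v (Suc n)" for n
  proof (induction n)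
    case (Suc n)
    then show ?case
      using h u(2) u(4)[of "Suc n"] by (auto simp: Gs_Suc glue_simps intro!: PL_homeos_glue)
  qed (simp add: Gs_0 h)
  have Gs_incr: "increasing_homeo (Gs n)" for n using Gs unfolding PL_homeos_def by blast
  \<comment> \<open>Passing from one stage to the next changes the map only to the left of the new gluing point.\<close>
  have stable: "Gs m x = Gs n x" if "u (Suc n) < x" "n \<le> m" for m n x
    using that(2)
  proof (induction m rule: dec_induct)
    case (step m)
    have "u (Suc m) \<le> u (Suc n)"
      using step(1) decseqD[OF decseq_SucI[of u, OF less_imp_le[OF u(4)]]] by simp
    then show ?case using step that by (simp add: Gs_Suc glue_def)
  qed simp
  define G where "G x = Gs (SOME n. u (Suc n) < x) x" for x
  have G_eq: "G x = Gs n x" if "u (Suc n) < x" for n x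
  proof -
    define m where "m = (SOME n. u (Suc n) < x)"
    have "u (Suc m) < x" unfolding m_def using that by (rule someI)
    then have "Gs m x = Gs n x" using stable that by (metis nat_le_linear)
    then show ?thesis unfolding G_def m_def .
  qed
  have ex: "\<exists>n. u (Suc n) < x" if "\<gamma> < x" for x
  proof -
    obtain n where "u n < x" using u(5)[OF \<open>\<gamma> < x\<close>] by blast
    then show ?thesis using u(4)[of n] by (intro exI[of _ n]) linarith
  qed
  show ?thesis
  proof (intro exI[of _ G] conjI allI impI)
    fix x y assume x: "\<gamma> < x" "x < y"
    obtain n where n: "u (Suc n) < x" using ex x by blast
    then show "G x < G y"
      using G_eq[of n x] G_eq[of n y] x increasing_homeo_less_iff[OF Gs_incr] by auto
  next
    fix x assume "\<gamma> < x"
    then obtain n where n: "u (Suc n) < x" using ex by blast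
    then have "v (Suc n) < G x"
      using G_eq[of n x] Gs[of n] increasing_homeo_less_iff[OF Gs_incr, of n "u (Suc n)" x] by auto
    then show "\<delta> < G x" using v(3)[of "Suc n"] by linarith
  next
    fix y assume "\<delta> < y"
    then obtain m where "v m < y" using v(5) by blast
    then obtain n where n: "v (Suc n) < y" using v(4)[of m] by (intro that[of m]) linarith
    define x where "x = inverse_map (Gs n) y"
    have x: "Gs n x = y" unfolding x_def using Gs_incr by simp
    then have "u (Suc n) < x"
      using n Gs[of n] increasing_homeo_less_iff[OF Gs_incr, of n "u (Suc n)" x] by auto
    then show "\<exists>x>\<gamma>. G x = y"
      using G_eq[of n x] x u(3)[of "Suc n"] by (intro exI[of _ x]) auto
  next
    fix x assume "\<gamma> < x"
    then obtain n where n: "u (Suc n) < x" using ex by blast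
    have "\<forall>\<^sub>F y in nhds x. y \<in> {u (Suc n)<..}" using n by (intro eventually_nhds_in_open) auto
    then have "\<forall>\<^sub>F y in nhds x. G y = Gs n y" by eventually_elim (simp add: G_eq)
    then show "dyadic_PL_at G x" using dyadic_PL_at_cong Gs[of n] unfolding PL_homeos_def by blast
  next
    show "G b = d" using G_eq[of 0 b] u(1) u(4)[of 0] h(2)[of 0] v(1) by (simp add: Gs_0)
  next
    fix x assume x: "\<gamma> < x" "x \<le> b"
    show "G (dil \<gamma> (- p) x) = dil \<delta> (- p') (G x)"
    proof (cases "p > 0")
      case True
      have Gs_eq: "Gs (Suc n) (dil \<gamma> (- p) x) = dil \<delta> (- p') (Gs n x)" for n
      proof (induction n)
        case 0
        have "dil \<gamma> (- p) x \<le> u (Suc 0)" using x u(1) u(6)[OF True, of 0] by simp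
        then show ?case using h_eq[OF True] by (simp add: Gs_0 Gs_Suc glue_def)
      next
        case (Suc n)
        have "dil \<gamma> (- p) x \<le> u (Suc (Suc n)) \<longleftrightarrow> x \<le> u (Suc n)" by (simp add: u(6)[OF True, of "Suc n"])
        then show ?case using h_eq[OF True] Suc
          by (simp add: Gs_Suc[of "Suc n"] Gs_Suc[of n] glue_def)
      qed
      obtain n where n: "u (Suc n) < x" using ex x by blast
      then have "u (Suc (Suc n)) < dil \<gamma> (- p) x" by (simp add: u(6)[OF True, of "Suc n"])
      then show ?thesis using Gs_eq[of n] G_eq[OF n] G_eq[of "Suc n"] by simp
    next
      case False
      then show ?thesis using p by auto
    qed
  qed
qed

section \<open>Intertwiners\<close>

text \<open>\<open>G\<close> carries the generator of the slopes at \<open>x\<close> to the generator of the slopes at \<open>G x\<close>; for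
irrational \<open>x\<close> and \<open>G x\<close> both generators are \<open>0\<close> and the equation is trivial.\<close>
definition self_similar_at :: "(real \<Rightarrow> real) \<Rightarrow> real \<Rightarrow> bool" where
  "self_similar_at G x \<longleftrightarrow> x \<notin> dyadic \<and> G x \<notin> dyadic \<and>
     (\<exists>p p'. period_generator x p \<and> period_generator (G x) p' \<and>
       (\<forall>\<^sub>F u in nhds x. G (dil x (- p) u) = dil (G x) (- p') (G u)))"

text \<open>When they fix \<open>0\<close> and \<open>1\<close>, these maps conjugate \<open>H\<^sub>U\<close> to the subgroup of the image of \<open>U\<close>: the
germs outside \<open>U\<close> are those of elements of \<open>F\<close>, and those at points of \<open>U\<close> are compatible with
the germs of the elements of \<open>F\<close> that fix these points.\<close>
definition intertwiner :: "real set \<Rightarrow> (real \<Rightarrow> real) \<Rightarrow> bool" where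
  "intertwiner U G \<longleftrightarrow> increasing_homeo G \<and> (\<forall>x. dyadic_PL_at G x \<or> x \<in> U \<and> self_similar_at G x)"

lemma self_similar_at_cong:
  assumes "\<forall>\<^sub>F y in nhds x. f y = g y" shows "self_similar_at f x \<longleftrightarrow> self_similar_at g x"
proof -
  have eq: "f x = g x" using assms by (rule eventually_nhds_x_imp_x)
  have "(\<forall>\<^sub>F u in nhds x. f (dil x (- p) u) = dil (g x) (- p') (f u)) \<longleftrightarrow>
      (\<forall>\<^sub>F u in nhds x. g (dil x (- p) u) = dil (g x) (- p') (g u))" for p p'
  proof (rule eventually_subst)
    show "\<forall>\<^sub>F u in nhds x. (f (dil x (- p) u) = dil (g x) (- p') (f u)) \<longleftrightarrow>
        (g (dil x (- p) u) = dil (g x) (- p') (g u))"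
      using dil_eventually[OF assms, of "- p"] assms by eventually_elim simp
  qed
  then show ?thesis unfolding self_similar_at_def eq by simp
qed

lemma period_generators_same_type:
  assumes "point_type \<gamma> = point_type \<delta>" "\<gamma> \<notin> dyadic"
  obtains p p' where "period_generator \<gamma> p" "period_generator \<delta> p'" "p = 0 \<and> p' = 0 \<or> 0 < p \<and> 0 < p'"
proof (cases "\<gamma> \<in> \<rat>")
  case True
  then have "\<delta> \<in> \<rat>" using assms by (auto simp: point_type_def split: if_splits)
  then show thesis using period_generator_rational True that by metis
next
  case False
  then have "\<delta> \<notin> \<rat>" using assms by (auto simp: point_type_def split: if_splits)
  then show thesis using period_generator_irrational False that by blast
qed

text \<open>The left half of the map is the reflection \<open>x \<mapsto> - x\<close> of a right half for \<open>- \<gamma>\<close> and \<open>- \<delta>\<close>, so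
\<open>half_line_homeo\<close> provides both.\<close>
lemma single_point_interpolation:
  assumes dy: "a \<in> dyadic" "b \<in> dyadic" "c \<in> dyadic" "d \<in> dyadic"
    and ord: "a < \<gamma>" "\<gamma> < b" "c < \<delta>" "\<delta> < d"
    and type: "point_type \<gamma> = point_type \<delta>"
  shows "\<exists>G. intertwiner {\<gamma>} G \<and> G a = c \<and> G \<gamma> = \<delta> \<and> G b = d"
proof (cases "\<gamma> \<in> dyadic")
  case True
  then have dy': "\<gamma> \<in> dyadic" "\<delta> \<in> dyadic" using type by (auto simp: point_type_def split: if_splits)
  obtain f where f: "f \<in> PL_homeos" "f a = c" "f \<gamma> = \<delta>" 
    using interpolation[OF dy(1) dy'(1) ord(1) dy(3) dy'(2) ord(3)] by blast
  obtain g where g: "g \<in> PL_homeos" "g \<gamma> = \<delta>" "g b = d" 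
    using interpolation[OF dy'(1) dy(2) ord(2) dy'(2) dy(4) ord(4)] by blast
  have "glue \<gamma> f g \<in> PL_homeos" using f g dy' by (intro PL_homeos_glue) auto
  then have "intertwiner {\<gamma>} (glue \<gamma> f g)" unfolding intertwiner_def PL_homeos_def by blast
  then show ?thesis using f g ord by (intro exI[of _ "glue \<gamma> f g"]) (auto simp: glue_def)
next
  case False
  then have dy': "\<gamma> \<notin> dyadic" "\<delta> \<notin> dyadic" using type by (auto simp: point_type_def split: if_splits)
  obtain p p' where p: "period_generator \<gamma> p" "period_generator \<delta> p'" "p = 0 \<and> p' = 0 \<or> 0 < p \<and> 0 < p'"
    using period_generators_same_type[OF type False] .
  have per: "(2 powi p - 1) * \<gamma> \<in> dyadic" "(2 powi p' - 1) * \<delta> \<in> dyadic"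
    using p period_generator_self by blast+
  then have per': "(2 powi p - 1) * - \<gamma> \<in> dyadic" "(2 powi p' - 1) * - \<delta> \<in> dyadic"
    by (simp_all only: mult_minus_right dyadic_minus_iff)
  obtain R where R': "\<forall>x>\<gamma>. \<forall>y>x. R x < R y" "\<forall>x>\<gamma>. \<delta> < R x" "\<forall>y>\<delta>. \<exists>x>\<gamma>. R x = y"
    "\<forall>x>\<gamma>. dyadic_PL_at R x" "R b = d"
    "\<forall>x. \<gamma> < x \<longrightarrow> x \<le> b \<longrightarrow> R (dil \<gamma> (- p) x) = dil \<delta> (- p') (R x)"
    using half_line_homeo[OF ord(2) dy(2) ord(4) dy(4) p(3) per] by (elim exE conjE)
  note R = R'[rule_format]
  have "- \<gamma> < - a" "- a \<in> dyadic" "- \<delta> < - c" "- c \<in> dyadic" using ord dy by auto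
  from half_line_homeo[OF this p(3) per']
  obtain L' where L'': "\<forall>x>-\<gamma>. \<forall>y>x. L' x < L' y" "\<forall>x>-\<gamma>. - \<delta> < L' x" "\<forall>y>-\<delta>. \<exists>x>-\<gamma>. L' x = y"
    "\<forall>x>-\<gamma>. dyadic_PL_at L' x" "L' (- a) = - c"
    "\<forall>x. - \<gamma> < x \<longrightarrow> x \<le> - a \<longrightarrow> L' (dil (- \<gamma>) (- p) x) = dil (- \<delta>) (- p') (L' x)"
    by (elim exE conjE)
  note L' = L''[rule_format]
  define L where "L x = - L' (- x)" for x
  have L: "x < y \<Longrightarrow> y < \<gamma> \<Longrightarrow> L x < L y" "x < \<gamma> \<Longrightarrow> L x < \<delta>" "L a = c" for x y
    using L'(1)[of "- y" "- x"] L'(2)[of "- x"] L'(5) by (simp_all add: L_def)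
  have L_surj: "\<exists>x<\<gamma>. L x = y" if y: "y < \<delta>" for y
  proof -
    obtain x where "x > - \<gamma>" "L' x = - y" using L'(3)[of "- y"] y by auto
    then show ?thesis by (intro exI[of _ "- x"]) (auto simp: L_def)
  qed
  have L_PL: "dyadic_PL_at L x" if "x < \<gamma>" for x
    using dyadic_PL_at_reflect[OF L'(4)[of "- x"]] that by (simp add: L_def[abs_def])
  have L_eq: "L (dil \<gamma> (- p) x) = dil \<delta> (- p') (L x)" if "x < \<gamma>" "a \<le> x" for x
    using L'(6)[of "- x"] that dil_minus[of \<gamma> "- p" x] dil_minus[of \<delta> "- p'" "L x"] by (simp add: L_def)
  define G where "G x = (if x < \<gamma> then L x else if x = \<gamma> then \<delta> else R x)" for x
  have "strict_mono G"
  proof (rule strict_monoI)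
    fix x y :: real assume "x < y"
    then show "G x < G y"
      using L(1)[of x y] L(2)[of x] R(1)[of x y] R(2)[of y] by (auto simp: G_def)
  qed
  moreover have "\<exists>x. G x = y" for y
  proof (cases y \<delta> rule: linorder_cases)
    case less
    then show ?thesis using L_surj[of y] by (auto simp: G_def)
  next
    case greater
    then obtain x where "x > \<gamma>" "R x = y" using R(3) by blast
    then show ?thesis by (intro exI[of _ x]) (auto simp: G_def)
  qed (auto simp: G_def)
  then have "surj G" unfolding surj_def by metis
  ultimately have G: "increasing_homeo G" unfolding increasing_homeo_def by blast
  have "dyadic_PL_at G x" if "x \<noteq> \<gamma>" for x
  proof (cases "x < \<gamma>")
    case True
    then have "\<forall>\<^sub>F y in nhds x. y \<in> {..<\<gamma>}" by (intro eventually_nhds_in_open) auto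
    then have "\<forall>\<^sub>F y in nhds x. G y = L y" by eventually_elim (simp add: G_def)
    then show ?thesis using dyadic_PL_at_cong L_PL[OF True] by blast
  next
    case False
    then have x: "\<gamma> < x" using that by simp
    then have "\<forall>\<^sub>F y in nhds x. y \<in> {\<gamma><..}" by (intro eventually_nhds_in_open) auto
    then have "\<forall>\<^sub>F y in nhds x. G y = R y" by eventually_elim (simp add: G_def)
    then show ?thesis using dyadic_PL_at_cong R(4)[OF x] by blast
  qed
  moreover have "self_similar_at G \<gamma>"
  proof -
    have "\<forall>\<^sub>F u in nhds \<gamma>. u \<in> {a<..<b}" using ord by (intro eventually_nhds_in_open) auto
    then have "\<forall>\<^sub>F u in nhds \<gamma>. G (dil \<gamma> (- p) u) = dil \<delta> (- p') (G u)"
    proof eventually_elim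
      case (elim u)
      show ?case
      proof (cases u \<gamma> rule: linorder_cases)
        case less
        then show ?thesis using L_eq[of u] elim by (simp add: G_def)
      next
        case greater
        then have "\<not> dil \<gamma> (- p) u < \<gamma>" "dil \<gamma> (- p) u \<noteq> \<gamma>"
          using dil_greater_centre[of \<gamma> "- p" u] by linarith+
        then show ?thesis using R(6)[of u] elim greater by (simp add: G_def)
      qed (simp add: G_def)
    qed
    moreover have "G \<gamma> = \<delta>" by (simp add: G_def)
    ultimately show ?thesis unfolding self_similar_at_def using p dy' by auto
  qed
  ultimately have "dyadic_PL_at G x \<or> x \<in> {\<gamma>} \<and> self_similar_at G x" for x
    by (cases "x = \<gamma>") auto
  then have "intertwiner {\<gamma>} G" unfolding intertwiner_def using G by blast
  moreover have "G a = c" "G \<gamma> = \<delta>" "G b = d" using L(3) R(5) ord by (auto simp: G_def)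
  ultimately show ?thesis by blast
qed

lemma dyadic_gap:
  assumes "sorted_wrt (<) (\<gamma> # us)"
  obtains m where "m \<in> dyadic" "\<gamma> < m" "\<And>x. x \<in> set us \<Longrightarrow> m < (x::real)"
proof -
  have "\<gamma> < Min (insert (\<gamma> + 1) (set us))" using assms by auto
  then obtain m where "m \<in> dyadic" "\<gamma> < m" "m < Min (insert (\<gamma> + 1) (set us))"
    using dyadic_between by blast
  then show thesis using that by auto
qed

text \<open>Each point is treated separately between dyadic points \<open>a < \<gamma> < m\<close>; the maps are glued at \<open>m\<close>,
where any two dyadic piecewise linear germs fit together.\<close>
lemma intertwiner_through_points:
  assumes "sorted_wrt (<) us" "sorted_wrt (<) vs" "map point_type us = map point_type vs"
    and "a \<in> dyadic" "c \<in> dyadic" "\<And>x. x \<in> set us \<Longrightarrow> a < x" "\<And>y. y \<in> set vs \<Longrightarrow> c < y"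
  shows "\<exists>G. intertwiner (set us) G \<and> G a = c \<and> map G us = vs"
  using assms
proof (induction us arbitrary: vs a c)
  case Nil
  have "(\<lambda>y. y + (c - a)) \<in> PL_homeos" using Nil by (intro PL_homeos_translation) simp
  then have "intertwiner (set []) (\<lambda>y. y + (c - a))" unfolding intertwiner_def PL_homeos_def by blast
  then show ?case using Nil.prems by (intro exI[of _ "\<lambda>y. y + (c - a)"]) auto
next
  case (Cons \<gamma> us)
  then obtain \<delta> vs' where vs: "vs = \<delta> # vs'" by (cases vs) auto
  obtain m where m: "m \<in> dyadic" "\<gamma> < m" "\<And>x. x \<in> set us \<Longrightarrow> m < x"
    using dyadic_gap[OF Cons.prems(1)] by blast
  obtain m' where m': "m' \<in> dyadic" "\<delta> < m'" "\<And>x. x \<in> set vs' \<Longrightarrow> m' < x"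
    using dyadic_gap Cons.prems(2) unfolding vs by blast
  obtain G1 where G1: "intertwiner {\<gamma>} G1" "G1 a = c" "G1 \<gamma> = \<delta>" "G1 m = m'"
    using single_point_interpolation[OF Cons.prems(4) m(1) Cons.prems(5) m'(1), of \<gamma> \<delta>] 
      m(2) m'(2) Cons.prems(3,6,7) unfolding vs by auto
  obtain G2 where G2: "intertwiner (set us) G2" "G2 m = m'" "map G2 us = vs'"
    using Cons.IH[of vs' m m'] Cons.prems(1-3) m m' unfolding vs by auto
  define G where "G = glue m G1 G2"
  have eq: "G1 m = G2 m" using G1 G2 by simp
  have "increasing_homeo G" unfolding G_def
    using G1 G2 eq by (intro increasing_homeo_glue) (auto simp: intertwiner_def)
  moreover have "dyadic_PL_at G x \<or> x \<in> set (\<gamma> # us) \<and> self_similar_at G x" for x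
  proof (cases x m rule: linorder_cases)
    case less
    note ev = eventually_glue(1)[OF less, of G1 G2, folded G_def]
    show ?thesis using G1(1) unfolding intertwiner_def dyadic_PL_at_cong[OF ev] self_similar_at_cong[OF ev] by auto
  next
    case greater
    note ev = eventually_glue(2)[OF greater, of G1 G2, folded G_def]
    show ?thesis using G2(1) unfolding intertwiner_def dyadic_PL_at_cong[OF ev] self_similar_at_cong[OF ev] by auto
  next
    case equal
    have "dyadic_PL_at G1 m" "dyadic_PL_at G2 m"
      using G1(1) G2(1) m unfolding intertwiner_def self_similar_at_def by auto
    then show ?thesis unfolding G_def equal using dyadic_PL_at_glue[of G1 m G2 m] eq m(1) by blast
  qed
  ultimately have "intertwiner (set (\<gamma> # us)) G" unfolding intertwiner_def by blast
  moreover have "G a = c" "G \<gamma> = \<delta>" using G1 m Cons.prems(6)[of \<gamma>] by (auto simp: G_def glue_def)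
  moreover have "map G us = vs'" 
  proof -
    have "map G us = map G2 us" using m(3) by (force simp: G_def glue_def)
    then show ?thesis using G2(3) by simp
  qed
  ultimately show ?case unfolding vs by auto
qed

section \<open>Conjugation by intertwiners\<close>

text \<open>The exponents for which the relation holds near \<open>x\<close> form a subgroup of \<open>\<int>\<close> containing \<open>- 1\<close>:
dilations about \<open>x\<close> preserve the filter of neighbourhoods of \<open>x\<close>.\<close>
lemma self_similar_at_iterate:
  assumes ss: "\<forall>\<^sub>F u in nhds x. G (dil x (- p) u) = dil (G x) (- p') (G u)"
  shows "\<forall>\<^sub>F u in nhds x. G (dil x (p * l) u) = dil (G x) (p' * l) (G u)"
proof -
  define E where "E l \<longleftrightarrow> (\<forall>\<^sub>F u in nhds x. G (dil x (p * l) u) = dil (G x) (p' * l) (G u))" for l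
  have neg: "E (- l)" if "E l" for l
  proof -
    have "\<forall>\<^sub>F u in nhds x. G (dil x (p * l) (dil x (p * - l) u)) = dil (G x) (p' * l) (G (dil x (p * - l) u))"
      using that unfolding E_def by (rule dil_eventually)
    then show ?thesis unfolding E_def
    proof eventually_elim
      case (elim u)
      then have "dil (G x) (p' * - l) (G u) = dil (G x) (p' * - l) (dil (G x) (p' * l) (G (dil x (p * - l) u)))"
        by simp
      then show ?case by simp
    qed
  qed
  have suc: "E (l + 1)" if "E l" "E 1" for l
  proof -
    have "\<forall>\<^sub>F u in nhds x. G (dil x (p * l) (dil x (p * 1) u)) = dil (G x) (p' * l) (G (dil x (p * 1) u))"
      using that unfolding E_def by (intro dil_eventually)
    moreover have "\<forall>\<^sub>F u in nhds x. G (dil x (p * 1) u) = dil (G x) (p' * 1) (G u)"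
      using that unfolding E_def by blast
    ultimately show ?thesis unfolding E_def
      by eventually_elim (simp add: algebra_simps)
  qed
  have "E (- 1)" using ss by (simp add: E_def)
  then have "E 1" using neg[of "- 1"] by simp
  have nat: "E (int n)" for n
  proof (induction n)
    case (Suc n)
    then show ?case using suc[of "int n"] \<open>E 1\<close> by (simp add: add.commute)
  qed (simp add: E_def)
  have "E l" using nat[of "nat l"] neg[OF nat[of "nat (- l)"]] by (cases "l \<ge> 0") auto
  then show ?thesis unfolding E_def .
qed

lemma intertwiner_inverse:
  assumes "intertwiner U G" shows "intertwiner (G ` U) (inverse_map G)"
proof -
  have G: "increasing_homeo G" using assms unfolding intertwiner_def by blast
  have "dyadic_PL_at (inverse_map G) y \<or> y \<in> G ` U \<and> self_similar_at (inverse_map G) y" for y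
  proof -
    define x where "x = inverse_map G y"
    have y: "y = G x" using G by (simp add: x_def)
    consider "dyadic_PL_at G x" | "x \<in> U" "self_similar_at G x" using assms unfolding intertwiner_def by blast
    then show ?thesis
    proof cases
      case 1
      then show ?thesis unfolding y using dyadic_PL_at_inv[OF G] by blast
    next
      case 2
      then obtain p p' where pp: "period_generator x p" "period_generator (G x) p'"
        and ss: "\<forall>\<^sub>F u in nhds x. G (dil x (- p) u) = dil (G x) (- p') (G u)"
        unfolding self_similar_at_def by blast
      have "\<forall>\<^sub>F z in nhds (G x). G (dil x (- p) (inverse_map G z)) = dil (G x) (- p') (G (inverse_map G z))"
        by (rule increasing_homeo_eventually[OF increasing_homeo_inv[OF G], of _ "G x"]) (simp add: G ss)
      then have "\<forall>\<^sub>F z in nhds (G x). inverse_map G (dil (G x) (- p') z) = dil x (- p) (inverse_map G z)"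
      proof eventually_elim
        case (elim z)
        then have "inverse_map G (dil (G x) (- p') z) = inverse_map G (G (dil x (- p) (inverse_map G z)))"
          using G by simp
        then show ?case using G by simp
      qed
      then have "self_similar_at (inverse_map G) (G x)"
        using 2 pp G unfolding self_similar_at_def by auto
      then show ?thesis unfolding y using 2 by blast
    qed
  qed
  then show ?thesis using G unfolding intertwiner_def by auto
qed

text \<open>At a self-similar point \<open>x\<close> the germ of \<open>F\<close> is a dilation by \<open>2\<^sup>k\<close> with \<open>k = p l\<close>, and \<open>G\<close>
turns it into the dilation by \<open>2\<^bsup>p' l\<^esup>\<close> about \<open>G x\<close>, which has a dyadic constant because
\<open>p'\<close> generates the slopes there. At all other points the composition consists of three dyadic
piecewise linear germs, since \<open>F\<close> does not move points into \<open>U\<close>.\<close>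
lemma intertwiner_conjugate:
  assumes "intertwiner U G" and F: "F \<in> PL_homeos" and fix_U: "\<And>x. x \<in> U \<Longrightarrow> F x = x"
  shows "G \<circ> F \<circ> inverse_map G \<in> PL_homeos"
proof -
  have G: "increasing_homeo G" using assms unfolding intertwiner_def by blast
  have F': "increasing_homeo F" "\<And>x. dyadic_PL_at F x" using F unfolding PL_homeos_def by auto
  have "dyadic_PL_at (G \<circ> F \<circ> inverse_map G) y" for y
  proof -
    define x where "x = inverse_map G y"
    have y: "y = G x" using G by (simp add: x_def)
    consider "x \<in> U" "self_similar_at G x" | "dyadic_PL_at G x" "dyadic_PL_at G (F x)"
    proof (cases "x \<in> U")
      case True
      then show thesis using that fix_U[OF True] assms(1) unfolding intertwiner_def by metis
    next
      case False
      then have "F x \<notin> U" using fix_U[of "F x"] increasing_homeo_eq_iff[OF F'(1), of "F x" x] by auto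
      then show thesis using that False assms(1) unfolding intertwiner_def by metis
    qed
    then show ?thesis
    proof cases
      case 2
      have "dyadic_PL_at (G \<circ> F) (inverse_map G (G x))"
        using dyadic_PL_at_comp[OF F'(1) F'(2) 2(2)] G by simp
      then show ?thesis unfolding y
        using dyadic_PL_at_comp[OF increasing_homeo_inv[OF G] dyadic_PL_at_inv[OF G 2(1)]] by blast
    next
      case 1
      have Fx: "F x = x" using 1 fix_U by blast
      obtain p p' where pp: "period_generator x p" "period_generator (G x) p'" and nd: "x \<notin> dyadic"
        and ss: "\<forall>\<^sub>F u in nhds x. G (dil x (- p) u) = dil (G x) (- p') (G u)"
        using 1 unfolding self_similar_at_def by blast
      obtain k where k: "\<forall>\<^sub>F u in nhds x. F u = x + 2 powi k * (u - x)"
        "x - 2 powi k * x \<in> dyadic"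
        using dyadic_PL_at_nondyadic[OF F'(2) nd] unfolding Fx by blast
      have "(2 powi k - 1) * x \<in> dyadic" using dyadic_minus[OF k(2)] by (simp add: algebra_simps)
      then obtain l where l: "k = p * l" using pp(1) unfolding period_generator_def by blast
      have "\<forall>\<^sub>F u in nhds x. G (F u) = dil (G x) (p' * l) (G u)"
        using self_similar_at_iterate[OF ss, of l] k(1)
        by eventually_elim (simp add: dil_def l)
      then have "\<forall>\<^sub>F z in nhds y. G (F (inverse_map G z)) = dil (G x) (p' * l) (G (inverse_map G z))"
        by (rule increasing_homeo_eventually[OF increasing_homeo_inv[OF G], of _ y, unfolded y increasing_homeo_inv_f[OF G], folded y])
      then have "\<forall>\<^sub>F z in nhds y. (G \<circ> F \<circ> inverse_map G) z
          = (G \<circ> F \<circ> inverse_map G) y + 2 powi (p' * l) * (z - y)"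
        by eventually_elim (simp add: G y Fx dil_def)
      moreover have "(G \<circ> F \<circ> inverse_map G) y - 2 powi (p' * l) * y \<in> dyadic"
      proof -
        have "(2 powi (p' * l) - 1) * y \<in> dyadic" using pp(2) unfolding y period_generator_def by simp
        then have "- ((2 powi (p' * l) - 1) * y) \<in> dyadic" by (rule dyadic_minus)
        moreover have "- ((2 powi (p' * l) - 1) * y) = (G \<circ> F \<circ> inverse_map G) y - 2 powi (p' * l) * y"
          using G by (simp add: y Fx algebra_simps)
        ultimately show ?thesis by simp
      qed
      ultimately show ?thesis by (rule dyadic_PL_atI)
    qed
  qed
  moreover have "increasing_homeo (G \<circ> F \<circ> inverse_map G)"
    using G F' by (intro increasing_homeo_comp increasing_homeo_inv) auto
  ultimately show ?thesis unfolding PL_homeos_def by blast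
qed

section \<open>Binary expansions and cones\<close>

text \<open>The number \<open>.p\<close> in binary, that is, the left end of the interval \<open>[p]\<close>.\<close>
primrec val :: "bool list \<Rightarrow> real" where
  "val [] = 0"
| "val (b # p) = (of_bool b + val p) / 2"

lemma val_append: "val (p @ r) = val p + val r / 2 ^ length p"
  by (induction p) (auto simp: field_simps)

lemma val_nonneg: "0 \<le> val p"
  by (induction p) auto

lemma val_upper: "val p + 1 / 2 ^ length p \<le> 1"
proof (induction p)
  case (Cons b p)
  have "val (b # p) + 1 / 2 ^ length (b # p) = (of_bool b + (val p + 1 / 2 ^ length p)) / 2"
    by (simp add: field_simps)
  also have "\<dots> \<le> (1 + 1) / 2" using Cons by (intro divide_right_mono add_mono) auto
  finally show ?case by simp
qed simp

lemma val_less_1: "val p < 1"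
proof -
  have "(0::real) < 1 / 2 ^ length p" by simp
  then show ?thesis using val_upper[of p] by linarith
qed

lemma val_inject:
  assumes "length p = length q" "val p = val q" shows "p = q"
  using assms
proof (induction p q rule: list_induct2)
  case (Cons b p c q)
  then have "of_bool b + val p = of_bool c + val q" by simp
  then have "b = c"
    using val_nonneg[of p] val_nonneg[of q] val_less_1[of p] val_less_1[of q]
    by (cases b; cases c) auto
  then show ?case using Cons by simp
qed simp

lemma val_eq_fraction: "\<exists>m::int. val p = of_int m / 2 ^ length p"
proof (induction p rule: rev_induct)
  case (snoc b p)
  then obtain m :: int where "val p = of_int m / 2 ^ length p" by blast
  then have "val (p @ [b]) = of_int (2 * m + of_bool b) / 2 ^ length (p @ [b])"
    by (simp add: val_append field_simps)
  then show ?case by blast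
qed simp

lemma val_dyadic: "val p \<in> dyadic" "val p + 1 / 2 ^ length p \<in> dyadic"
proof -
  show "val p \<in> dyadic" using val_eq_fraction[of p] unfolding dyadic_def by blast
  moreover have "1 / 2 ^ length p \<in> dyadic"
    unfolding dyadic_def by (intro CollectI exI[of _ 1] exI[of _ "length p"]) simp
  ultimately show "val p + 1 / 2 ^ length p \<in> dyadic" by (rule dyadic_add)
qed

lemma val_surj:
  assumes "m < 2 ^ n" shows "\<exists>p. length p = n \<and> val p = of_nat m / 2 ^ n"
  using assms
proof (induction n arbitrary: m)
  case (Suc n)
  have "m div 2 < 2 ^ n" using Suc.prems by auto
  then obtain p where p: "length p = n" "val p = of_nat (m div 2) / 2 ^ n" using Suc.IH by blast
  have "real m = 2 * real (m div 2) + of_bool (odd m)"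
    by (cases "even m") (auto elim!: evenE oddE)
  then have "val (p @ [odd m]) = of_nat m / 2 ^ Suc n"
    using p by (simp add: val_append field_simps)
  then show ?case using p by (intro exI[of _ "p @ [odd m]"]) simp
qed simp

abbreviation prefix_of :: "(nat \<Rightarrow> bool) \<Rightarrow> nat \<Rightarrow> bool list" where
  "prefix_of w n \<equiv> map w [0..<n]"

lemma bin_summable: "summable (\<lambda>n. of_bool (w n) / 2 ^ Suc n :: real)"
proof (rule summable_comparison_test')
  show "summable (\<lambda>n. (1 / 2) ^ Suc n :: real)" using power_half_series by (rule sums_summable)
  show "norm (of_bool (w n) / 2 ^ Suc n :: real) \<le> (1 / 2) ^ Suc n" if "n \<ge> 0" for n
    by (simp add: power_one_over field_simps)
qed

lemma bin_nonneg: "0 \<le> bin w"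
  unfolding bin_def by (rule suminf_nonneg[OF bin_summable]) simp

lemma bin_le_1: "bin w \<le> 1"
proof -
  have "bin w \<le> (\<Sum>n. (1 / 2) ^ Suc n)" unfolding bin_def
    by (rule suminf_le[OF _ bin_summable sums_summable[OF power_half_series]])
      (simp add: power_one_over field_simps)
  also have "\<dots> = 1" using power_half_series by (rule sums_unique[symmetric])
  finally show ?thesis .
qed

lemma bin_shift: "bin w = (of_bool (w 0) + bin (\<lambda>n. w (Suc n))) / 2"
proof -
  have "bin w = (\<Sum>n. of_bool (w (Suc n)) / 2 ^ Suc (Suc n)) + of_bool (w 0) / 2"
    unfolding bin_def using suminf_split_head[OF bin_summable[of w]] by simp
  also have "(\<Sum>n. of_bool (w (Suc n)) / 2 ^ Suc (Suc n)) = bin (\<lambda>n. w (Suc n)) / 2"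
    unfolding bin_def using suminf_divide[OF bin_summable[of "\<lambda>n. w (Suc n)"], of 2] by (simp add: mult.commute)
  finally show ?thesis by simp
qed

lemma bin_prefix: "bin w = val (prefix_of w n) + bin (\<lambda>i. w (i + n)) / 2 ^ n"
proof (induction n)
  case (Suc n)
  have "bin (\<lambda>i. w (i + n)) = (of_bool (w n) + bin (\<lambda>i. w (i + Suc n))) / 2"
    using bin_shift[of "\<lambda>i. w (i + n)"] by simp
  then show ?case using Suc by (simp add: val_append field_simps)
qed simp

lemma bin_prefix_bounds:
  "val (prefix_of w n) \<le> bin w" "bin w \<le> val (prefix_of w n) + 1 / 2 ^ n"
  using bin_nonneg[of "\<lambda>i. w (i + n)"] bin_le_1[of "\<lambda>i. w (i + n)"]
  by (subst bin_prefix[of w n], simp add: divide_right_mono)+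

lemma left_end_eq: "left_end p = val p"
proof -
  have "prefix_of (pad p False) (length p) = p" by (rule nth_equalityI) (simp_all add: pad_def)
  moreover have "bin (\<lambda>i. pad p False (i + length p)) = 0" by (simp add: pad_def bin_def)
  ultimately show ?thesis using bin_prefix[of "pad p False" "length p"] by simp
qed

lemma right_end_eq: "right_end p = val p + 1 / 2 ^ length p"
proof -
  have "prefix_of (pad p True) (length p) = p" by (rule nth_equalityI) (simp_all add: pad_def)
  moreover have "bin (\<lambda>i. pad p True (i + length p)) = 1"
    using sums_unique[OF power_half_series] by (simp add: pad_def bin_def power_one_over)
  ultimately show ?thesis using bin_prefix[of "pad p True" "length p"] by simp
qed

text \<open>The digits are the parities of \<open>\<lfloor>2\<^sup>n x\<rfloor>\<close>, so that the first \<open>n\<close> of them form the number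
\<open>\<lfloor>2\<^sup>n x\<rfloor> / 2\<^sup>n\<close>.\<close>
lemma bin_surj:
  assumes "0 \<le> x" "x < 1" shows "\<exists>w. bin w = x"
proof -
  define w where "w n = odd \<lfloor>2 ^ Suc n * x\<rfloor>" for n :: nat
  have pre: "val (prefix_of w n) = of_int \<lfloor>2 ^ n * x\<rfloor> / 2 ^ n" for n
  proof (induction n)
    case 0
    have "\<lfloor>x\<rfloor> = 0" using assms by linarith
    then show ?case by simp
  next
    case (Suc n)
    define y where "y = 2 ^ n * x"
    have "\<lfloor>2 * y\<rfloor> = 2 * \<lfloor>y\<rfloor> \<or> \<lfloor>2 * y\<rfloor> = 2 * \<lfloor>y\<rfloor> + 1" by linarith
    then have "\<lfloor>2 * y\<rfloor> = 2 * \<lfloor>y\<rfloor> + of_bool (odd \<lfloor>2 * y\<rfloor>)" by auto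
    moreover have "w n = odd \<lfloor>2 * y\<rfloor>" by (simp add: w_def y_def mult.assoc)
    ultimately have "\<lfloor>2 * y\<rfloor> = 2 * \<lfloor>y\<rfloor> + of_bool (w n)" by simp
    then have "of_int \<lfloor>2 * y\<rfloor> = 2 * of_int \<lfloor>y\<rfloor> + (of_bool (w n) :: real)" by simp
    then show ?case using Suc by (simp add: val_append y_def field_simps)
  qed
  have "\<bar>bin w - x\<bar> \<le> (1 / 2) ^ n" for n
  proof -
    have "of_int \<lfloor>2 ^ n * x\<rfloor> / 2 ^ n \<le> x" "x \<le> of_int \<lfloor>2 ^ n * x\<rfloor> / 2 ^ n + 1 / 2 ^ n"
    proof -
      have "of_int \<lfloor>2 ^ n * x\<rfloor> \<le> 2 ^ n * x" "2 ^ n * x \<le> of_int \<lfloor>2 ^ n * x\<rfloor> + 1" by linarith+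
      then show "of_int \<lfloor>2 ^ n * x\<rfloor> / 2 ^ n \<le> x" "x \<le> of_int \<lfloor>2 ^ n * x\<rfloor> / 2 ^ n + 1 / 2 ^ n"
        by (simp_all add: field_simps)
    qed
    then show ?thesis using bin_prefix_bounds[of w n] unfolding pre power_one_over by linarith
  qed
  moreover have "\<exists>n. (1 / 2) ^ n < \<bar>bin w - x\<bar>" if "bin w \<noteq> x"
    using real_arch_pow_inv[of "\<bar>bin w - x\<bar>" "1 / 2"] that by simp
  ultimately have "bin w = x" by (meson not_less)
  then show ?thesis by blast
qed

text \<open>A nondyadic number lies in the interior of exactly one interval \<open>[p]\<close> of each length.\<close>
lemma prefix_unique:
  assumes nd: "bin w \<notin> dyadic" and p: "val p \<le> bin w" "bin w \<le> val p + 1 / 2 ^ length p"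
  shows "prefix_of w (length p) = p"
proof -
  define n where "n = length p"
  define q where "q = prefix_of w n"
  have len: "length q = n" by (simp add: q_def)
  obtain a b :: int where ab: "val p = of_int a / 2 ^ n" "val q = of_int b / 2 ^ n"
    using val_eq_fraction[of p] val_eq_fraction[of q] len n_def by metis
  have "val p < bin w" "bin w < val p + 1 / 2 ^ n"
    using p nd val_dyadic[of p] n_def by (metis order_less_le)+
  then have "of_int a < 2 ^ n * bin w" "2 ^ n * bin w < of_int a + 1"
    unfolding ab by (simp_all add: field_simps)
  moreover have "val q \<le> bin w" "bin w \<le> val q + 1 / 2 ^ n"
    using bin_prefix_bounds[of w n] by (simp_all add: q_def)
  then have "of_int b \<le> 2 ^ n * bin w" "2 ^ n * bin w \<le> of_int b + 1"
    unfolding ab by (simp_all add: field_simps)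
  ultimately have "real_of_int a < of_int (b + 1)" "real_of_int b < of_int (a + 1)" by simp_all
  then have "a = b" by linarith
  then have "val q = val p" using ab by simp
  then show ?thesis using val_inject[of q p] len by (simp add: q_def n_def)
qed

lemma bin_inject_nondyadic:
  assumes "bin w \<notin> dyadic" "bin w = bin v" shows "w = v"
proof
  fix n
  have "prefix_of w (length (prefix_of v (Suc n))) = prefix_of v (Suc n)"
    using assms bin_prefix_bounds[of v "Suc n"] by (intro prefix_unique) auto
  then have "prefix_of w (Suc n) = prefix_of v (Suc n)" by (simp only: length_map length_upt diff_zero)
  then have "\<forall>i\<in>set [0..<Suc n]. w i = v i" by (simp only: map_eq_conv)
  then show "w n = v n" by simp
qed

text \<open>The cone of a finite word \<open>p\<close> is the interval \<open>[p]\<close> of the numbers with an expansion that starts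
with \<open>p\<close>. Being linear on a cone and mapping it onto another one is inherited by all smaller cones,
with the same suffix on both sides.\<close>
definition maps_cone :: "(real \<Rightarrow> real) \<Rightarrow> bool list \<Rightarrow> bool list \<Rightarrow> bool" where
  "maps_cone G p q \<longleftrightarrow> (\<forall>t\<in>{0..1}. G (val p + t / 2 ^ length p) = val q + t / 2 ^ length q)"

lemma maps_cone_append:
  assumes "maps_cone G p q" shows "maps_cone G (p @ r) (q @ r)"
  unfolding maps_cone_def
proof
  fix t :: real assume t: "t \<in> {0..1}"
  have "0 \<le> t / 2 ^ length r" "t / 2 ^ length r \<le> 1 / 2 ^ length r"
    using t by (auto intro: divide_right_mono)
  then have "val r + t / 2 ^ length r \<in> {0..1}" using val_nonneg[of r] val_upper[of r] by simp
  then have "G (val p + (val r + t / 2 ^ length r) / 2 ^ length p) = val q + (val r + t / 2 ^ length r) / 2 ^ length q"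
    using assms unfolding maps_cone_def by blast
  moreover have "val (s @ r) + t / 2 ^ length (s @ r) = val s + (val r + t / 2 ^ length r) / 2 ^ length s" for s
    by (simp add: val_append power_add add_divide_distrib)
  ultimately show "G (val (p @ r) + t / 2 ^ length (p @ r)) = val (q @ r) + t / 2 ^ length (q @ r)"
    by simp
qed

lemma maps_cone_inverse:
  assumes "increasing_homeo G" "maps_cone G p q" shows "maps_cone (inverse_map G) q p"
  unfolding maps_cone_def
proof
  fix t :: real assume "t \<in> {0..1}"
  then have "G (val p + t / 2 ^ length p) = val q + t / 2 ^ length q"
    using assms(2) unfolding maps_cone_def by blast
  then show "inverse_map G (val q + t / 2 ^ length q) = val p + t / 2 ^ length p"
    using increasing_homeo_inv_f[OF assms(1)] by metis
qed

lemma maps_cone_ends: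
  assumes "maps_cone G p q"
  shows "G (val p) = val q" "G (val p + 1 / 2 ^ length p) = val q + 1 / 2 ^ length q"
proof -
  have "(0::real) \<in> {0..1}" "(1::real) \<in> {0..1}" by simp_all
  then show "G (val p) = val q" "G (val p + 1 / 2 ^ length p) = val q + 1 / 2 ^ length q"
    using assms unfolding maps_cone_def by force+
qed

lemma maps_cone_unique:
  assumes "maps_cone G p q" "maps_cone G p q'" shows "q = q'"
proof -
  have eq: "val q = val q'" using maps_cone_ends(1)[OF assms(1)] maps_cone_ends(1)[OF assms(2)] by simp
  have "val q + 1 / 2 ^ length q = val q' + 1 / 2 ^ length q'"
    using maps_cone_ends(2)[OF assms(1)] maps_cone_ends(2)[OF assms(2)] by simp
  then have "(2::real) ^ length q = 2 ^ length q'" using eq by simp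
  then have "length q = length q'" by simp
  then show ?thesis using eq by (rule val_inject)
qed

text \<open>If \<open>G\<close> is \<open>y \<mapsto> 2\<^sup>j y + c\<close> on \<open>[p]\<close>, the image has length \<open>2\<^bsup>j - n\<^esup>\<close> with \<open>n\<close> the length of \<open>p\<close>,
and its left end is a multiple of this length as soon as \<open>n - j\<close> is at least the exponent \<open>s\<close> of
the denominator of \<open>c\<close>. So the image is again the interval of a finite word.\<close>
lemma affine_maps_cone:
  assumes aff: "\<And>y. val p \<le> y \<Longrightarrow> y \<le> val p + 1 / 2 ^ length p \<Longrightarrow> G y = 2 powi j * y + c"
    and c: "c = of_int c1 / 2 ^ s" and large: "int s + j \<le> int (length p)" "j \<le> int (length p)"
    and unit: "0 \<le> G (val p)" "G (val p + 1 / 2 ^ length p) \<le> 1"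
  shows "\<exists>q. maps_cone G p q"
proof -
  define n where "n = length p"
  define n' where "n' = nat (int n - j)"
  have n': "s \<le> n'" "int n' = int n - j" using large by (auto simp: n'_def n_def)
  obtain a :: int where a: "val p = of_int a / 2 ^ n" using val_eq_fraction n_def by blast
  define m where "m = a + c1 * 2 ^ (n' - s)"
  have pow: "2 powi j / 2 ^ n = (1 / 2 ^ n' :: real)"
  proof -
    have "2 powi j = (2 powi (int n - int n') :: real)" using n'(2) by simp
    also have "\<dots> = 2 powi (int n) / 2 powi (int n')" by (rule power_int_diff) simp
    finally show ?thesis by simp
  qed
  have "(2::real) ^ n' = 2 ^ s * 2 ^ (n' - s)" using n'(1) by (simp flip: power_add)
  then have c': "c = of_int (c1 * 2 ^ (n' - s)) / 2 ^ n'" by (simp add: c)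
  have G: "G (val p + t / 2 ^ n) = of_int m / 2 ^ n' + t / 2 ^ n'" if t: "t \<in> {0..1}" for t
  proof -
    have "0 \<le> t / 2 ^ n" "t / 2 ^ n \<le> 1 / 2 ^ n" using t by (auto intro: divide_right_mono)
    then have "G (val p + t / 2 ^ n) = 2 powi j * (val p + t / 2 ^ n) + c"
      by (intro aff) (simp_all add: n_def)
    also have "\<dots> = (of_int a + t) * (2 powi j / 2 ^ n) + c" by (simp add: a field_simps)
    also have "\<dots> = of_int m / 2 ^ n' + t / 2 ^ n'" unfolding pow c' m_def by (simp add: add_divide_distrib)
    finally show ?thesis .
  qed
  have "0 \<le> of_int m / (2::real) ^ n'" using G[of 0] unit(1) by simp
  then have "m \<ge> 0" by (simp add: pos_le_divide_eq)
  have "of_int m / 2 ^ n' + 1 / 2 ^ n' \<le> (1::real)" using G[of 1] unit(2) by (simp add: n_def)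
  then have "of_int (m + 1) \<le> (of_int (2 ^ n') :: real)" by (simp add: field_simps)
  then have "m < 2 ^ n'" by linarith
  then have "nat m < 2 ^ n'" using \<open>m \<ge> 0\<close> by (simp add: nat_less_iff)
  then obtain q where q: "length q = n'" "val q = of_nat (nat m) / 2 ^ n'" using val_surj by blast
  then have "maps_cone G p q" unfolding maps_cone_def using G \<open>m \<ge> 0\<close> by (simp add: n_def)
  then show ?thesis by blast
qed

text \<open>A dyadic number is never interior to a short interval \<open>[p]\<close>, so a break at such a number does not
prevent \<open>G\<close> from being linear on the short intervals that contain it.\<close>
lemma cone_one_side_of_dyadic:
  assumes "x = of_int m / 2 ^ s" "s \<le> length p" "val p \<le> x" "x \<le> val p + 1 / 2 ^ length p"
  shows "x = val p \<or> x = val p + 1 / 2 ^ length p"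
proof -
  define n where "n = length p"
  obtain a :: int where a: "val p = of_int a / 2 ^ n" using val_eq_fraction n_def by blast
  have "(2::real) ^ n = 2 ^ s * 2 ^ (n - s)" using assms(2) by (simp add: n_def flip: power_add)
  then have x: "x = of_int (m * 2 ^ (n - s)) / 2 ^ n" by (simp add: assms(1))
  define m' where "m' = m * 2 ^ (n - s)"
  have "real_of_int a \<le> of_int m'" "real_of_int m' \<le> of_int a + 1"
    using assms(3,4) unfolding x a n_def[symmetric] m'_def[symmetric] by (simp_all add: field_simps)
  then have "m' = a \<or> m' = a + 1" by linarith
  then show ?thesis unfolding x a n_def[symmetric] m'_def[symmetric] by (auto simp: add_divide_distrib)
qed

text \<open>All sufficiently long prefixes of any expansion of a point with a dyadic piecewise linear germ
work.\<close>
lemma maps_cone_at_PL_point: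
  assumes G: "increasing_homeo G" "G 0 = 0" "G 1 = 1" and PL: "dyadic_PL_at G (bin w)"
  shows "\<exists>n q. maps_cone G (prefix_of w n) q"
proof -
  define x where "x = bin w"
  obtain k l where kl: "\<forall>\<^sub>F y in nhds x. G y = G x + (if y \<le> x then 2 powi k else 2 powi l) * (y - x)"
    "G x - 2 powi k * x \<in> dyadic" "G x - 2 powi l * x \<in> dyadic" "x \<notin> dyadic \<longrightarrow> k = l"
    using PL unfolding dyadic_PL_at_def x_def by blast
  obtain ck sk where ck: "G x - 2 powi k * x = of_int ck / 2 ^ sk" using kl(2) unfolding dyadic_def by blast
  obtain cl sl where cl: "G x - 2 powi l * x = of_int cl / 2 ^ sl" using kl(3) unfolding dyadic_def by blast
  obtain e where e: "e > 0" "\<And>y. dist y x < e \<Longrightarrow> G y = G x + (if y \<le> x then 2 powi k else 2 powi l) * (y - x)"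
    using kl(1) unfolding eventually_nhds_metric by blast
  obtain mx sx where mx: "x \<in> dyadic \<longrightarrow> x = of_int mx / 2 ^ sx" unfolding dyadic_def by blast
  obtain N where N: "(1 / 2) ^ N < e" using real_arch_pow_inv[of e "1 / 2"] e(1) by auto
  define n where "n = N + sx + nat (int sk + k) + nat (int sl + l) + nat k + nat l"
  have n: "N \<le> n" "sx \<le> n" "int sk + k \<le> int n" "int sl + l \<le> int n" "k \<le> int n" "l \<le> int n"
    unfolding n_def by linarith+
  define p where "p = prefix_of w n"
  have len: "length p = n" by (simp add: p_def)
  have x_in: "val p \<le> x" "x \<le> val p + 1 / 2 ^ n" using bin_prefix_bounds[of w n] by (simp_all add: p_def x_def)
  have "(1 / 2 :: real) ^ n \<le> (1 / 2) ^ N" using n(1) by (intro power_decreasing) auto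
  then have small: "1 / 2 ^ n < e" using N by (simp add: power_one_over)
  have near: "G y = G x + (if y \<le> x then 2 powi k else 2 powi l) * (y - x)"
    if "val p \<le> y" "y \<le> val p + 1 / 2 ^ n" for y
    using e(2)[of y] that x_in small by (simp add: dist_real_def abs_if)
  have unit: "0 \<le> G (val p)" "G (val p + 1 / 2 ^ length p) \<le> 1"
    using increasing_homeo_le_iff[OF G(1), of 0 "val p"] val_nonneg[of p]
      increasing_homeo_le_iff[OF G(1), of "val p + 1 / 2 ^ length p" 1] val_upper[of p] G by simp_all
  have "(\<forall>y. val p \<le> y \<longrightarrow> y \<le> val p + 1 / 2 ^ length p \<longrightarrow> G y = 2 powi k * y + (G x - 2 powi k * x)) \<or>
      (\<forall>y. val p \<le> y \<longrightarrow> y \<le> val p + 1 / 2 ^ length p \<longrightarrow> G y = 2 powi l * y + (G x - 2 powi l * x))"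
  proof (cases "x \<in> dyadic")
    case True
    then have "x = val p \<or> x = val p + 1 / 2 ^ n"
      using cone_one_side_of_dyadic[of x mx sx p] mx n(2) x_in len by simp
    then show ?thesis
    proof
      assume *: "x = val p"
      have "G y = 2 powi l * y + (G x - 2 powi l * x)" if "val p \<le> y" "y \<le> val p + 1 / 2 ^ length p" for y
        using near[of y] that * len by (cases "y = x") (auto simp: algebra_simps)
      then show ?thesis by blast
    next
      assume *: "x = val p + 1 / 2 ^ n"
      have "G y = 2 powi k * y + (G x - 2 powi k * x)" if "val p \<le> y" "y \<le> val p + 1 / 2 ^ length p" for y
        using near[of y] that * len by (auto simp: algebra_simps)
      then show ?thesis by blast
    qed
  next
    case False
    then have "k = l" using kl(4) by blast
    have "G y = 2 powi k * y + (G x - 2 powi k * x)" if "val p \<le> y" "y \<le> val p + 1 / 2 ^ length p" for y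
      using near[of y] that len \<open>k = l\<close> by (cases "y \<le> x") (simp_all add: algebra_simps)
    then show ?thesis by blast
  qed
  then have "\<exists>q. maps_cone G p q"
  proof
    assume "\<forall>y. val p \<le> y \<longrightarrow> y \<le> val p + 1 / 2 ^ length p \<longrightarrow> G y = 2 powi k * y + (G x - 2 powi k * x)"
    then show ?thesis using affine_maps_cone[of p G k _ ck sk] ck n(3,5) len unit by blast
  next
    assume "\<forall>y. val p \<le> y \<longrightarrow> y \<le> val p + 1 / 2 ^ length p \<longrightarrow> G y = 2 powi l * y + (G x - 2 powi l * x)"
    then show ?thesis using affine_maps_cone[of p G l _ cl sl] cl n(4,6) len unit by blast
  qed
  then show ?thesis unfolding p_def by blast
qed

section \<open>The tree triple of an intertwiner\<close>

text \<open>The vertices of the tree whose finite branches are the maximal intervals \<open>[p]\<close> mapped linearly onto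
some \<open>[q]\<close>: no proper prefix \<open>r\<close> of a vertex has this property.\<close>
definition cone_tree :: "(real \<Rightarrow> real) \<Rightarrow> bool list set" where
  "cone_tree G = {p. \<forall>r s q. p = r @ s \<longrightarrow> maps_cone G r q \<longrightarrow> s = []}"

lemma snoc_in_cone_tree: "p @ [b] \<in> cone_tree G \<longleftrightarrow> p \<in> cone_tree G \<and> (\<nexists>q. maps_cone G p q)"
proof
  assume a: "p @ [b] \<in> cone_tree G"
  have "s = []" if "p = r @ s" "maps_cone G r q" for r s q
  proof -
    have "p @ [b] = r @ (s @ [b])" using that by simp
    then have "s @ [b] = []" using a that unfolding cone_tree_def by blast
    then show ?thesis by simp
  qed
  moreover have "\<not> maps_cone G p q" for q
  proof
    assume "maps_cone G p q"
    then have "[b] = []" using a unfolding cone_tree_def by blast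
    then show False by simp
  qed
  ultimately show "p \<in> cone_tree G \<and> (\<nexists>q. maps_cone G p q)" unfolding cone_tree_def by blast
next
  assume a: "p \<in> cone_tree G \<and> (\<nexists>q. maps_cone G p q)"
  have "s = []" if eq: "p @ [b] = r @ s" and m: "maps_cone G r q" for r s q
  proof (cases s rule: rev_cases)
    case (snoc s' c)
    then have p: "p = r @ s'" using eq by simp
    then have "s' = []" using a m unfolding cone_tree_def by blast
    then show ?thesis using p m a by auto
  qed
  then show "p @ [b] \<in> cone_tree G" unfolding cone_tree_def by blast
qed

lemma full_binary_cone_tree: "full_binary_tree (cone_tree G)"
  unfolding full_binary_tree_def snoc_in_cone_tree by (auto simp: cone_tree_def)

lemma fin_branch_cone_tree:
  "FinBranch p \<in> branches (cone_tree G) \<longleftrightarrow> p \<in> cone_tree G \<and> (\<exists>q. maps_cone G p q)"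
  unfolding branches_def fin_branches_def inf_branches_def by (auto simp: snoc_in_cone_tree)

lemma inf_branch_cone_tree:
  "InfBranch w \<in> branches (cone_tree G) \<longleftrightarrow> (\<forall>n q. \<not> maps_cone G (prefix_of w n) q)"
proof -
  have "(\<forall>n. prefix_of w n \<in> cone_tree G) \<longleftrightarrow> (\<forall>n q. \<not> maps_cone G (prefix_of w n) q)"
  proof (intro iffI allI)
    fix n q assume "\<forall>n. prefix_of w n \<in> cone_tree G"
    then have "prefix_of w (Suc n) \<in> cone_tree G" by blast
    then show "\<not> maps_cone G (prefix_of w n) q" by (auto simp: snoc_in_cone_tree)
  next
    fix n assume "\<forall>n q. \<not> maps_cone G (prefix_of w n) q"
    then show "prefix_of w n \<in> cone_tree G"
      by (induction n) (auto simp: snoc_in_cone_tree, simp add: cone_tree_def)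
  qed
  then show ?thesis unfolding branches_def fin_branches_def inf_branches_def by auto
qed

lemma inf_branches_eq: "inf_branches T = {b \<in> branches T. \<exists>w. b = InfBranch w}"
  unfolding branches_def fin_branches_def inf_branches_def by auto

lemma full_binary_tree_prefix:
  assumes "full_binary_tree T" shows "r @ s \<in> T \<Longrightarrow> r \<in> T"
proof (induction s rule: rev_induct)
  case (snoc b s)
  then have "(r @ s) @ [b] \<in> T" by simp
  then have "r @ s \<in> T" using assms unfolding full_binary_tree_def by blast
  then show ?case by (rule snoc.IH)
qed simp

lemma branch_prefix_in_tree:
  assumes T: "full_binary_tree T" and b: "b \<in> branches T" and r: "\<forall>i<length r. letter b i = Some (r ! i)"
  shows "r \<in> T"
proof (cases b)
  case (FinBranch p)
  have len: "length r \<le> length p"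
  proof (rule ccontr)
    assume "\<not> length r \<le> length p"
    then show False using r[rule_format, of "length p"] by (simp add: FinBranch)
  qed
  have "r = take (length r) p"
    using r len by (intro nth_equalityI) (auto simp: FinBranch split: if_splits)
  then have "p = r @ drop (length r) p" by (metis append_take_drop_id)
  moreover have "p \<in> T" using b unfolding FinBranch branches_def fin_branches_def inf_branches_def by auto
  ultimately show ?thesis using full_binary_tree_prefix[OF T] by metis
next
  case (InfBranch w)
  have "r = prefix_of w (length r)"
    using r by (intro nth_equalityI) (auto simp: InfBranch)
  moreover have "prefix_of w n \<in> T" for n
    using b unfolding InfBranch branches_def fin_branches_def inf_branches_def by auto
  ultimately show ?thesis by metis
qed

text \<open>A finite branch is a leaf, so no other branch properly extends it.\<close>
lemma no_shorter_branch:
  assumes T: "full_binary_tree T" and ab: "a \<in> branches T" "b \<in> branches T"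
    and agree: "\<forall>i<n. letter a i = letter b i" and "letter a n = None" shows "letter b n = None"
proof (rule ccontr)
  assume "letter b n \<noteq> None"
  then obtain c where c: "letter b n = Some c" by blast
  obtain p where p: "a = FinBranch p" "length p \<le> n"
    using assms(5) by (cases a) (auto split: if_splits)
  have "length p = n"
  proof (rule ccontr)
    assume "length p \<noteq> n"
    then have "letter a (length p) = letter b (length p)" using agree p(2) by simp
    then have "letter b (length p) = None" by (simp add: p(1))
    then show False using c p(2) by (cases b) (auto split: if_splits)
  qed
  then have "\<forall>i<length (p @ [c]). letter b i = Some ((p @ [c]) ! i)"
    using agree c p by (auto simp: nth_append less_Suc_eq)
  then have "p @ [c] \<in> T" by (rule branch_prefix_in_tree[OF T ab(2)])
  moreover have "p @ [c] \<notin> T"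
    using ab(1) unfolding p(1) branches_def fin_branches_def inf_branches_def by auto
  ultimately show False by blast
qed

lemma letter_inject:
  assumes "\<And>n. letter a n = letter b n" shows "a = b"
proof (cases a; cases b)
  fix p q assume ab: "a = FinBranch p" "b = FinBranch q"
  have "n < length p \<longleftrightarrow> n < length q" for n using assms[of n] ab by (auto split: if_splits)
  then have len: "length p = length q" by (metis linorder_neqE_nat less_irrefl)
  have "p = q"
  proof (rule nth_equalityI[OF len])
    fix i assume "i < length p"
    then show "p ! i = q ! i" using assms[of i] ab len by simp
  qed
  then show ?thesis using ab by simp
next
  fix p v assume "a = FinBranch p" "b = InfBranch v"
  then show ?thesis using assms[of "length p"] by simp
next
  fix v p assume "a = InfBranch v" "b = FinBranch p"
  then show ?thesis using assms[of "length p"] by simp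
next
  fix v w assume "a = InfBranch v" "b = InfBranch w"
  then show ?thesis using assms by auto
qed

lemma branches_linear:
  assumes T: "full_binary_tree T" and ab: "a \<in> branches T" "b \<in> branches T" and "a \<noteq> b"
  shows "left_of a b \<or> left_of b a"
proof (rule ccontr)
  assume no: "\<not> (left_of a b \<or> left_of b a)"
  have "letter a n = letter b n" for n
  proof (induction n rule: less_induct)
    case (less n)
    then have agree: "\<forall>i<n. letter a i = letter b i" "\<forall>i<n. letter b i = letter a i" by simp_all
    show ?case
    proof (cases "letter a n")
      case None
      then show ?thesis using no_shorter_branch[OF T ab agree(1)] by simp
    next
      case (Some x)
      then obtain y where y: "letter b n = Some y"
        using no_shorter_branch[OF T ab(2,1) agree(2)] by fastforce
      have "x = y"
      proof (rule ccontr)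
        assume "x \<noteq> y"
        then have "(x = False \<and> y = True) \<or> (x = True \<and> y = False)" by auto
        then have "left_of a b \<or> left_of b a"
          unfolding left_of_def using agree Some y by (elim disjE) (blast intro: exI[of _ n])+
        then show False using no by blast
      qed
      then show ?thesis using Some y by simp
    qed
  qed
  then show False using letter_inject[of a b] assms(4) by blast
qed

fun branch_left :: "branch \<Rightarrow> real" where
  "branch_left (FinBranch p) = val p"
| "branch_left (InfBranch w) = bin w"

fun branch_right :: "branch \<Rightarrow> real" where
  "branch_right (FinBranch p) = val p + 1 / 2 ^ length p"
| "branch_right (InfBranch w) = bin w"

lemma branch_left_le_right: "branch_left b \<le> branch_right b"
  by (cases b) simp_all

lemma branch_in_cone:
  assumes r: "\<forall>i<length r. letter b i = Some (r ! i)"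
  shows "val r \<le> branch_left b" "branch_right b \<le> val r + 1 / 2 ^ length r"
proof -
  have "val r \<le> branch_left b \<and> branch_right b \<le> val r + 1 / 2 ^ length r"
  proof (cases b)
    case (FinBranch p)
    have len: "length r \<le> length p"
    proof (rule ccontr)
      assume "\<not> length r \<le> length p"
      then show False using r[rule_format, of "length p"] by (simp add: FinBranch)
    qed
    define s where "s = drop (length r) p"
    have "r = take (length r) p"
      using r len by (intro nth_equalityI) (auto simp: FinBranch split: if_splits)
    then have p: "p = r @ s" unfolding s_def by (metis append_take_drop_id)
    have "val p + 1 / 2 ^ length p = val r + (val s + 1 / 2 ^ length s) / 2 ^ length r"
      by (simp add: p val_append power_add add_divide_distrib)
    also have "\<dots> \<le> val r + 1 / 2 ^ length r"
      using val_upper[of s] by (intro add_left_mono divide_right_mono) auto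
    finally show ?thesis using val_nonneg[of s] by (simp add: FinBranch) (simp add: p val_append)
  next
    case (InfBranch w)
    have "r = prefix_of w (length r)"
      using r by (intro nth_equalityI) (auto simp: InfBranch)
    then show ?thesis using bin_prefix_bounds[of w "length r"] by (simp add: InfBranch)
  qed
  then show "val r \<le> branch_left b" "branch_right b \<le> val r + 1 / 2 ^ length r" by auto
qed

text \<open>If \<open>r\<close> is the longest common prefix of the two branches, then \<open>a\<close> belongs to the left half of \<open>[r]\<close>
and \<open>b\<close> to the right half.\<close>
lemma left_of_imp_le:
  assumes "left_of a b" shows "branch_right a \<le> branch_left b"
proof -
  obtain n where n: "\<forall>i<n. letter a i = letter b i" "letter a n = Some False" "letter b n = Some True"
    using assms unfolding left_of_def by blast
  define r where "r = map (\<lambda>i. the (letter a i)) [0..<n]"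
  have some: "\<exists>c. letter a i = Some c" if "i < n" for i
    using n(2) that by (cases a) (auto split: if_splits)
  have r: "length r = n" "\<forall>i<n. letter a i = Some (r ! i)" using some by (auto simp: r_def)
  have "\<forall>i<length (r @ [False]). letter a i = Some ((r @ [False]) ! i)"
    using r n by (auto simp: nth_append less_Suc_eq)
  from branch_in_cone(2)[OF this] have "branch_right a \<le> val r + 1 / 2 ^ Suc n"
    using r(1) by (simp add: val_append)
  also have "\<dots> = val (r @ [True])" using r(1) by (simp add: val_append)
  also have "\<forall>i<length (r @ [True]). letter b i = Some ((r @ [True]) ! i)"
    using r n by (auto simp: nth_append less_Suc_eq)
  from branch_in_cone(1)[OF this] have "val (r @ [True]) \<le> branch_left b" .
  finally show ?thesis .
qed

lemma left_of_irrefl: "\<not> left_of a a"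
  unfolding left_of_def by auto

text \<open>For an infinite branch the choice is harmless: the value at an exceptional point is not dyadic
and thus has a unique binary expansion.\<close>
fun branch_map :: "(real \<Rightarrow> real) \<Rightarrow> branch \<Rightarrow> branch" where
  "branch_map G (FinBranch p) = FinBranch (THE q. maps_cone G p q)"
| "branch_map G (InfBranch w) = InfBranch (SOME v. bin v = G (bin w))"

lemma branch_map_FinBranch: "maps_cone G p q \<Longrightarrow> branch_map G (FinBranch p) = FinBranch q"
  using maps_cone_unique by (auto intro!: the_equality)

lemma unit_interval_maps:
  assumes "increasing_homeo G" "G 0 = 0" "G 1 = 1" "0 \<le> x" "x \<le> 1"
  shows "0 \<le> G x" "G x \<le> 1"
  using increasing_homeo_le_iff[OF assms(1), of 0 x] increasing_homeo_le_iff[OF assms(1), of x 1] assms by auto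

lemma inf_branch_exceptional:
  assumes G: "intertwiner U G" "G 0 = 0" "G 1 = 1" and w: "InfBranch w \<in> branches (cone_tree G)"
  shows "bin w \<in> U" "bin w \<notin> dyadic" "G (bin w) \<notin> dyadic"
proof -
  have "\<not> dyadic_PL_at G (bin w)"
    using maps_cone_at_PL_point[of G w] G w unfolding inf_branch_cone_tree intertwiner_def by blast
  then have "bin w \<in> U" "self_similar_at G (bin w)" using G(1) unfolding intertwiner_def by blast+
  then show "bin w \<in> U" "bin w \<notin> dyadic" "G (bin w) \<notin> dyadic" unfolding self_similar_at_def by blast+
qed

lemma branch_map_InfBranch:
  assumes G: "intertwiner U G" "G 0 = 0" "G 1 = 1" and w: "InfBranch w \<in> branches (cone_tree G)"
  obtains v where "branch_map G (InfBranch w) = InfBranch v" "bin v = G (bin w)"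
proof -
  have inc: "increasing_homeo G" using G(1) unfolding intertwiner_def by blast
  have "0 \<le> G (bin w)" "G (bin w) \<le> 1"
    using unit_interval_maps[OF inc G(2,3) bin_nonneg bin_le_1] by blast+
  moreover have "G (bin w) \<noteq> 1" using inf_branch_exceptional(3)[OF G w] by auto
  ultimately have "\<exists>v. bin v = G (bin w)" by (intro bin_surj) auto
  then have "bin (SOME v. bin v = G (bin w)) = G (bin w)" by (rule someI_ex)
  then show thesis by (intro that) simp_all
qed

lemma inverse_inverse_map: "increasing_homeo G \<Longrightarrow> inverse_map (inverse_map G) = G"
  by (rule inv_inv_eq[OF increasing_homeo_bij])

text \<open>Maximality is preserved in both directions: if a proper prefix of \<open>q\<close> were mapped linearly by the
inverse of \<open>G\<close>, its image would be a larger interval than \<open>[p]\<close> on which \<open>G\<close> is linear.\<close>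
lemma branch_map_into:
  assumes G: "intertwiner U G" "G 0 = 0" "G 1 = 1" and b: "b \<in> branches (cone_tree G)"
  shows "branch_map G b \<in> branches (cone_tree (inverse_map G)) \<and> branch_map (inverse_map G) (branch_map G b) = b"
proof -
  have inc: "increasing_homeo G" using G(1) unfolding intertwiner_def by blast
  note inc' = increasing_homeo_inv[OF inc]
  show ?thesis
  proof (cases b)
    case (FinBranch p)
    then obtain q where p: "p \<in> cone_tree G" and q: "maps_cone G p q" using b fin_branch_cone_tree by blast
    have q': "maps_cone (inverse_map G) q p" by (rule maps_cone_inverse[OF inc q])
    have "s = []" if qs: "q = r @ s" and r: "maps_cone (inverse_map G) r r'" for r s r'
    proof -
      have "maps_cone (inverse_map G) q (r' @ s)" unfolding qs by (rule maps_cone_append[OF r])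
      then have "p = r' @ s" by (rule maps_cone_unique[OF q'])
      moreover have "maps_cone G r' r" using maps_cone_inverse[OF inc' r] inverse_inverse_map[OF inc] by simp
      ultimately show ?thesis using p unfolding cone_tree_def by blast
    qed
    then have "q \<in> cone_tree (inverse_map G)" unfolding cone_tree_def by blast
    then show ?thesis
      unfolding FinBranch branch_map_FinBranch[OF q] branch_map_FinBranch[OF q'] fin_branch_cone_tree
      using q' by blast
  next
    case (InfBranch w)
    have w: "InfBranch w \<in> branches (cone_tree G)" using b InfBranch by simp
    obtain v where v: "branch_map G (InfBranch w) = InfBranch v" "bin v = G (bin w)"
      by (rule branch_map_InfBranch[OF G w])
    have nd: "bin w \<notin> dyadic" using inf_branch_exceptional[OF G w] by blast
    have "\<not> maps_cone (inverse_map G) (prefix_of v n) p" for n p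
    proof
      assume m: "maps_cone (inverse_map G) (prefix_of v n) p"
      have m': "maps_cone G p (prefix_of v n)" using maps_cone_inverse[OF inc' m] inverse_inverse_map[OF inc] by simp
      have "G (val p) \<le> G (bin w)" "G (bin w) \<le> G (val p + 1 / 2 ^ length p)"
        using maps_cone_ends[OF m'] bin_prefix_bounds[of v n] v(2) by simp_all
      then have "prefix_of w (length p) = p"
        using increasing_homeo_le_iff[OF inc] by (intro prefix_unique[OF nd]) auto
      then show False using w m' unfolding inf_branch_cone_tree by metis
    qed
    then have v_in: "InfBranch v \<in> branches (cone_tree (inverse_map G))" unfolding inf_branch_cone_tree by blast
    obtain u where u: "branch_map (inverse_map G) (InfBranch v) = InfBranch u" "bin u = inverse_map G (bin v)"
      by (rule branch_map_InfBranch[OF intertwiner_inverse[OF G(1)] inverse_unit[OF inc G(2,3)] v_in])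
    have "bin w = bin u" using u(2) v(2) inc by simp
    then have "w = u" by (rule bin_inject_nondyadic[OF nd])
    then show ?thesis using v_in u(1) v(1) InfBranch by simp
  qed
qed

lemma branch_map_ends:
  assumes G: "intertwiner U G" "G 0 = 0" "G 1 = 1" and b: "b \<in> branches (cone_tree G)"
  shows "branch_left (branch_map G b) = G (branch_left b)" "branch_right (branch_map G b) = G (branch_right b)"
proof -
  have "branch_left (branch_map G b) = G (branch_left b) \<and> branch_right (branch_map G b) = G (branch_right b)"
  proof (cases b)
    case (FinBranch p)
    then obtain q where q: "maps_cone G p q" using b fin_branch_cone_tree by blast
    show ?thesis unfolding FinBranch branch_map_FinBranch[OF q] using maps_cone_ends[OF q] by simp
  next
    case (InfBranch w)
    have w: "InfBranch w \<in> branches (cone_tree G)" using b InfBranch by simp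
    obtain v where "branch_map G (InfBranch w) = InfBranch v" "bin v = G (bin w)"
      by (rule branch_map_InfBranch[OF G w])
    then show ?thesis unfolding InfBranch by (simp only: branch_left.simps branch_right.simps)
  qed
  then show "branch_left (branch_map G b) = G (branch_left b)" "branch_right (branch_map G b) = G (branch_right b)"
    by auto
qed

text \<open>\<open>G\<close> is increasing, so the images of two branches in the wrong order would have to share a
point with both branches degenerate to it; such a point is not dyadic and has only one expansion.\<close>
lemma branch_map_left_of:
  assumes G: "intertwiner U G" "G 0 = 0" "G 1 = 1"
    and ab: "a \<in> branches (cone_tree G)" "b \<in> branches (cone_tree G)" "left_of a b"
  shows "left_of (branch_map G a) (branch_map G b)"
proof (rule ccontr)
  have inc: "increasing_homeo G" using G(1) unfolding intertwiner_def by blast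
  assume no: "\<not> left_of (branch_map G a) (branch_map G b)"
  have neq: "a \<noteq> b" using ab(3) left_of_irrefl by blast
  have "branch_map G a \<noteq> branch_map G b"
    using branch_map_into[OF G ab(1)] branch_map_into[OF G ab(2)] neq by metis
  then have "left_of (branch_map G b) (branch_map G a)"
    using branches_linear[OF full_binary_cone_tree] branch_map_into[OF G ab(1)] branch_map_into[OF G ab(2)] no by blast
  then have "G (branch_right b) \<le> G (branch_left a)"
    using left_of_imp_le branch_map_ends[OF G ab(1)] branch_map_ends[OF G ab(2)] by metis
  then have "branch_right b \<le> branch_left a" by (simp only: increasing_homeo_le_iff[OF inc])
  then have eq: "branch_left a = branch_right a" "branch_left b = branch_right b" "branch_left a = branch_left b"
    using left_of_imp_le[OF ab(3)] branch_left_le_right[of a] branch_left_le_right[of b] by linarith+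
  obtain w where w: "a = InfBranch w" using eq(1) by (cases a) auto
  obtain v where v: "b = InfBranch v" using eq(2) by (cases b) auto
  have "bin w = bin v" using eq(3) w v by simp
  moreover have "bin w \<notin> dyadic" using inf_branch_exceptional[OF G] ab(1) w by blast
  ultimately have "w = v" using bin_inject_nondyadic by blast
  then show False using neq w v by simp
qed

lemma finite_inf_branches_cone_tree:
  assumes G: "intertwiner U G" "G 0 = 0" "G 1 = 1" and U: "finite U"
  shows "finite (inf_branches (cone_tree G))"
proof (rule inj_on_finite[OF _ _ U])
  have inf: "\<exists>w. b = InfBranch w \<and> InfBranch w \<in> branches (cone_tree G)" if "b \<in> inf_branches (cone_tree G)" for b
    using that unfolding inf_branches_eq by blast
  show "inj_on branch_left (inf_branches (cone_tree G))"
  proof (rule inj_onI)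
    fix a b assume "a \<in> inf_branches (cone_tree G)" "b \<in> inf_branches (cone_tree G)" "branch_left a = branch_left b"
    then show "a = b"
      using inf[of a] inf[of b] inf_branch_exceptional(2)[OF G] bin_inject_nondyadic by auto
  qed
  show "branch_left ` inf_branches (cone_tree G) \<subseteq> U"
    using inf inf_branch_exceptional(1)[OF G] by fastforce
qed

lemma restrict_in_tree_group:
  assumes G: "intertwiner U G" "G 0 = 0" "G 1 = 1" and U: "finite U"
  shows "restrict G I01 \<in> carrier tree_group"
proof -
  have inc: "increasing_homeo G" using G(1) unfolding intertwiner_def by blast
  define H where "H = inverse_map G"
  have HG: "inverse_map H = G" unfolding H_def by (rule inverse_inverse_map[OF inc])
  have H: "intertwiner (G ` U) H" "H 0 = 0" "H 1 = 1"
    unfolding H_def using intertwiner_inverse[OF G(1)] inverse_unit[OF inc G(2,3)] by auto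
  have into_G: "branch_map G b \<in> branches (cone_tree H)" "branch_map H (branch_map G b) = b"
    if "b \<in> branches (cone_tree G)" for b
    using branch_map_into[OF G that] unfolding H_def by auto
  have into_H: "branch_map H b \<in> branches (cone_tree G)" "branch_map G (branch_map H b) = b"
    if "b \<in> branches (cone_tree H)" for b
    using branch_map_into[OF H that] unfolding HG by auto
  have bij: "bij_betw (branch_map G) (branches (cone_tree G)) (branches (cone_tree H))"
    by (rule bij_betw_byWitness[where f' = "branch_map H"]) (use into_G into_H in auto)
  have inf_G: "branch_map G ` inf_branches (cone_tree G) \<subseteq> inf_branches (cone_tree H)"
    unfolding inf_branches_eq using into_G by auto
  have inf_H: "branch_map H ` inf_branches (cone_tree H) \<subseteq> inf_branches (cone_tree G)"
    unfolding inf_branches_eq using into_H by auto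
  have sub: "inf_branches T \<subseteq> branches T" for T unfolding branches_def by blast
  have "bij_betw (branch_map G) (inf_branches (cone_tree G)) (inf_branches (cone_tree H))"
    by (rule bij_betw_byWitness[where f' = "branch_map H"]) (use into_G into_H sub inf_G inf_H in blast)+
  then have card: "card (inf_branches (cone_tree G)) = card (inf_branches (cone_tree H))"
    by (rule bij_betw_same_card)
  have "tree_triple (cone_tree G) (cone_tree H) (branch_map G)"
    unfolding tree_triple_def
    using full_binary_cone_tree finite_inf_branches_cone_tree[OF G U]
      finite_inf_branches_cone_tree[OF H finite_imageI[OF U]] card bij inf_G branch_map_left_of[OF G]
    by blast
  moreover have "induces (cone_tree G) (branch_map G) (restrict G I01)"
    unfolding induces_def
  proof (intro conjI allI impI ballI)
    fix p q and t :: real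
    assume a: "FinBranch p \<in> branches (cone_tree G) \<and> branch_map G (FinBranch p) = FinBranch q" and t: "t \<in> {0..1}"
    then obtain q' where q': "maps_cone G p q'" using fin_branch_cone_tree by blast
    then have "maps_cone G p q" using a branch_map_FinBranch[OF q'] by simp
    then have eq: "G (val p + t / 2 ^ length p) = val q + t / 2 ^ length q" using t unfolding maps_cone_def by blast
    have conv: "(1 - t) * left_end r + t * right_end r = val r + t / 2 ^ length r" for r
      unfolding left_end_eq right_end_eq by (simp add: algebra_simps)
    have "0 \<le> t / 2 ^ length p" "t / 2 ^ length p \<le> 1 / 2 ^ length p"
      using t by (auto intro: divide_right_mono)
    then have "val p + t / 2 ^ length p \<in> I01" using val_nonneg[of p] val_upper[of p] by simp
    then show "restrict G I01 ((1 - t) * left_end p + t * right_end p) = (1 - t) * left_end q + t * right_end q"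
      unfolding conv using eq by simp
  next
    fix u v assume a: "InfBranch u \<in> branches (cone_tree G) \<and> branch_map G (InfBranch u) = InfBranch v"
    then have "bin v = G (bin u)" using branch_map_ends(1)[OF G, of "InfBranch u"] by simp
    then show "restrict G I01 (bin u) = bin v" using bin_nonneg[of u] bin_le_1[of u] by simp
  qed
  ultimately show ?thesis
    unfolding tree_group_def using restrict_in_homeo_group[OF inc G(2,3)] by auto
qed

section \<open>Conjugating the fixing subgroups\<close>

lemma tree_group_Bij: "f \<in> carrier tree_group \<Longrightarrow> f \<in> Bij I01"
  unfolding tree_group_def homeo_group_def by simp

lemma tree_group_mult: "mult tree_group = mult (BijGroup I01)"
  and tree_group_one: "one tree_group = one (BijGroup I01)"
  unfolding tree_group_def homeo_group_def by simp_all

lemma restrict_Bij: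
  assumes "increasing_homeo F" "F 0 = 0" "F 1 = 1" shows "restrict F I01 \<in> Bij I01"
  using restrict_in_homeo_group[OF assms] unfolding homeo_group_def by simp

lemma tree_group_mult_restrict:
  assumes F: "increasing_homeo F" "F 0 = 0" "F 1 = 1" and G: "increasing_homeo G" "G 0 = 0" "G 1 = 1"
  shows "restrict G I01 \<otimes>\<^bsub>tree_group\<^esub> restrict F I01 = restrict (G \<circ> F) I01"
proof -
  have "compose I01 (restrict G I01) (restrict F I01) = restrict (G \<circ> F) I01"
    unfolding compose_def using unit_interval_maps[OF F] by (auto simp: restrict_def)
  then show ?thesis unfolding tree_group_mult BijGroup_def
    using restrict_Bij[OF F] restrict_Bij[OF G] by (simp del: restrict_apply add: restrict_apply')
qed

text \<open>The inverse is taken in \<open>tree_group\<close>, so it has to be checked that the inverse map belongs to its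
carrier; uniqueness comes from the group of all bijections.\<close>
lemma inv_tree_group_restrict:
  assumes G: "intertwiner U G" "G 0 = 0" "G 1 = 1" and U: "finite U"
  shows "inv\<^bsub>tree_group\<^esub> (restrict G I01) = restrict (inverse_map G) I01"
proof -
  have inc: "increasing_homeo G" using G(1) unfolding intertwiner_def by blast
  note H01 = inverse_unit[OF inc G(2,3)]
  note inc' = increasing_homeo_inv[OF inc]
  have comp: "G \<circ> inverse_map G = (\<lambda>x. x)" "inverse_map G \<circ> G = (\<lambda>x. x)" using inc by auto
  have one: "\<one>\<^bsub>tree_group\<^esub> = restrict (\<lambda>x. x) I01" unfolding tree_group_one BijGroup_def by simp
  have mem: "restrict G I01 \<in> carrier tree_group" "restrict (inverse_map G) I01 \<in> carrier tree_group"
    using restrict_in_tree_group[OF G U]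
      restrict_in_tree_group[OF intertwiner_inverse[OF G(1)] H01 finite_imageI[OF U]] by auto
  interpret B: group "BijGroup I01" by (rule group_BijGroup)
  have carr: "carrier (BijGroup I01) = Bij I01" by (simp add: BijGroup_def)
  show ?thesis unfolding m_inv_def
  proof (rule the_equality)
    show *: "restrict (inverse_map G) I01 \<in> carrier tree_group \<and>
        restrict G I01 \<otimes>\<^bsub>tree_group\<^esub> restrict (inverse_map G) I01 = \<one>\<^bsub>tree_group\<^esub> \<and>
        restrict (inverse_map G) I01 \<otimes>\<^bsub>tree_group\<^esub> restrict G I01 = \<one>\<^bsub>tree_group\<^esub>"
      unfolding tree_group_mult_restrict[OF inc' H01 inc G(2,3)] tree_group_mult_restrict[OF inc G(2,3) inc' H01]
      unfolding comp one using mem by simp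
    fix y assume y: "y \<in> carrier tree_group \<and> restrict G I01 \<otimes>\<^bsub>tree_group\<^esub> y = \<one>\<^bsub>tree_group\<^esub> \<and>
        y \<otimes>\<^bsub>tree_group\<^esub> restrict G I01 = \<one>\<^bsub>tree_group\<^esub>"
    show "y = restrict (inverse_map G) I01"
    proof (rule B.inv_unique[of y "restrict G I01" "restrict (inverse_map G) I01"])
      show "y \<otimes>\<^bsub>BijGroup I01\<^esub> restrict G I01 = \<one>\<^bsub>BijGroup I01\<^esub>"
        using y unfolding tree_group_mult tree_group_one by blast
      show "restrict G I01 \<otimes>\<^bsub>BijGroup I01\<^esub> restrict (inverse_map G) I01 = \<one>\<^bsub>BijGroup I01\<^esub>"
        using * unfolding tree_group_mult tree_group_one by blast
    qed (use mem y tree_group_Bij carr in blast)+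
  qed
qed

lemma fixing_subgroup_eq:
  assumes "U \<subseteq> I01"
  shows "fixing_subgroup U = {restrict F I01 | F. F \<in> PL_homeos \<and> F 0 = 0 \<and> F 1 = 1 \<and> (\<forall>x\<in>U. F x = x)}"
proof (intro equalityI subsetI)
  fix f assume f: "f \<in> fixing_subgroup U"
  then obtain F where F: "F \<in> PL_homeos" "F 0 = 0" "F 1 = 1" "f = restrict F I01"
    using thompson_F_extends unfolding fixing_subgroup_def by blast
  have "F x = x" if "x \<in> U" for x
  proof -
    have "f x = x" using f that unfolding fixing_subgroup_def by blast
    moreover have "x \<in> I01" using that assms by blast
    ultimately show ?thesis by (simp add: F(4))
  qed
  then show "f \<in> {restrict F I01 | F. F \<in> PL_homeos \<and> F 0 = 0 \<and> F 1 = 1 \<and> (\<forall>x\<in>U. F x = x)}" using F by blast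
next
  fix f assume "f \<in> {restrict F I01 | F. F \<in> PL_homeos \<and> F 0 = 0 \<and> F 1 = 1 \<and> (\<forall>x\<in>U. F x = x)}"
  then obtain F where F: "F \<in> PL_homeos" "F 0 = 0" "F 1 = 1" "\<forall>x\<in>U. F x = x" "f = restrict F I01" by blast
  then show "f \<in> fixing_subgroup U"
    unfolding fixing_subgroup_def using PL_homeos_restrict_in_thompson_F assms by auto
qed

lemma intertwiner_conjugates_fixing_subgroups:
  assumes G: "intertwiner U G" "G 0 = 0" "G 1 = 1" and U: "finite U" "U \<subseteq> I01"
  shows "conjugate_in tree_group (fixing_subgroup U) (fixing_subgroup (G ` U))"
proof -
  have inc: "increasing_homeo G" using G(1) unfolding intertwiner_def by blast
  define H where "H = inverse_map G"
  have inc': "increasing_homeo H" and H01: "H 0 = 0" "H 1 = 1"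
    unfolding H_def using inc inverse_unit[OF inc G(2,3)] by auto
  have HG: "inverse_map H = G" unfolding H_def by (rule inverse_inverse_map[OF inc])
  have GH [simp]: "G (H y) = y" "H (G y) = y" for y using inc by (simp_all add: H_def)
  have GU: "G ` U \<subseteq> I01" using U(2) unit_interval_maps[OF inc G(2,3)] by auto
  have conj: "restrict G I01 \<otimes>\<^bsub>tree_group\<^esub> restrict F I01 \<otimes>\<^bsub>tree_group\<^esub> inv\<^bsub>tree_group\<^esub> (restrict G I01)
      = restrict (G \<circ> F \<circ> H) I01" if F: "F \<in> PL_homeos" "F 0 = 0" "F 1 = 1" for F
  proof -
    have F': "increasing_homeo F" using F unfolding PL_homeos_def by blast
    have GF: "increasing_homeo (G \<circ> F)" "(G \<circ> F) 0 = 0" "(G \<circ> F) 1 = 1"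
      using increasing_homeo_comp[OF F' inc] F G by simp_all
    show ?thesis
      unfolding inv_tree_group_restrict[OF G U(1)] H_def[symmetric] tree_group_mult_restrict[OF F' F(2,3) inc G(2,3)]
        tree_group_mult_restrict[OF inc' H01 GF] ..
  qed
  have "fixing_subgroup (G ` U)
      = restrict G I01 <#\<^bsub>tree_group\<^esub> fixing_subgroup U #>\<^bsub>tree_group\<^esub> inv\<^bsub>tree_group\<^esub> (restrict G I01)" (is "?L = ?R")
  proof (intro equalityI subsetI)
    fix k assume "k \<in> ?L"
    then obtain K where K: "K \<in> PL_homeos" "K 0 = 0" "K 1 = 1" "\<forall>y\<in>G ` U. K y = y" and k: "k = restrict K I01"
      unfolding fixing_subgroup_eq[OF GU] by blast
    define F where "F = H \<circ> K \<circ> G"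
    have "H \<circ> K \<circ> inverse_map H \<in> PL_homeos"
      using intertwiner_conjugate[OF intertwiner_inverse[OF G(1)] K(1)] K(4) unfolding H_def by blast
    then have F: "F \<in> PL_homeos" "F 0 = 0" "F 1 = 1" "\<forall>x\<in>U. F x = x"
      using K G H01 by (auto simp: F_def HG)
    then have "restrict F I01 \<in> fixing_subgroup U" unfolding fixing_subgroup_eq[OF U(2)] by blast
    moreover have "G \<circ> F \<circ> H = K" by (auto simp: F_def)
    then have "k = restrict G I01 \<otimes>\<^bsub>tree_group\<^esub> restrict F I01 \<otimes>\<^bsub>tree_group\<^esub> inv\<^bsub>tree_group\<^esub> (restrict G I01)"
      unfolding conj[OF F(1-3)] k by simp
    ultimately show "k \<in> ?R" unfolding l_coset_def r_coset_def by blast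
  next
    fix k assume "k \<in> ?R"
    then obtain f where f: "f \<in> fixing_subgroup U"
      and k: "k = restrict G I01 \<otimes>\<^bsub>tree_group\<^esub> f \<otimes>\<^bsub>tree_group\<^esub> inv\<^bsub>tree_group\<^esub> (restrict G I01)"
      unfolding l_coset_def r_coset_def by blast
    obtain F where F: "F \<in> PL_homeos" "F 0 = 0" "F 1 = 1" "\<forall>x\<in>U. F x = x" and f': "f = restrict F I01"
      using f unfolding fixing_subgroup_eq[OF U(2)] by blast
    have "G \<circ> F \<circ> H \<in> PL_homeos"
      unfolding H_def using intertwiner_conjugate[OF G(1) F(1)] F(4) by blast
    moreover have "(G \<circ> F \<circ> H) 0 = 0" "(G \<circ> F \<circ> H) 1 = 1" "\<forall>y\<in>G ` U. (G \<circ> F \<circ> H) y = y"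
      using F G H01 by simp_all
    ultimately show "k \<in> ?L"
      unfolding fixing_subgroup_eq[OF GU] k f' conj[OF F(1-3)] by blast
  qed
  then show ?thesis unfolding conjugate_in_def using restrict_in_tree_group[OF G U(1)] by blast
qed

text \<open>Adding the dyadic points \<open>0\<close> and \<open>1\<close> to both lists makes the map preserve the unit interval.\<close>
lemma intertwiner_exists:
  assumes "finite U" "U \<subseteq> {0<..<1}" "finite V" "V \<subseteq> {0<..<1}" "type_word U = type_word V"
  obtains G where "intertwiner U G" "G 0 = 0" "G 1 = 1" "G ` U = V"
proof -
  define us where "us = sorted_list_of_set U"
  define vs where "vs = sorted_list_of_set V"
  have us: "sorted_wrt (<) us" "set us = U" and vs: "sorted_wrt (<) vs" "set vs = V"
    using assms by (simp_all add: us_def vs_def strict_sorted_list_of_set)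
  have sorted: "sorted_wrt (<) (0 # us @ [1])" "sorted_wrt (<) (0 # vs @ [1])"
    using us vs assms by (auto simp: sorted_wrt_append)
  have types: "map point_type (0 # us @ [1]) = map point_type (0 # vs @ [1])"
    using assms(5) by (simp add: type_word_def us_def vs_def)
  have m1: "- 1 \<in> dyadic" using dyadic_minus[of 1] by simp
  have "\<exists>G. intertwiner (set (0 # us @ [1])) G \<and> G (- 1) = - 1 \<and> map G (0 # us @ [1]) = 0 # vs @ [1]"
  proof (rule intertwiner_through_points[OF sorted types m1 m1])
    fix x assume "x \<in> set (0 # us @ [1])"
    then show "- 1 < x" using us(2) assms(2) by auto
  next
    fix y assume "y \<in> set (0 # vs @ [1])"
    then show "- 1 < y" using vs(2) assms(4) by auto
  qed
  then obtain G where G: "intertwiner (set (0 # us @ [1])) G" "map G (0 # us @ [1]) = 0 # vs @ [1]"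
    by (elim exE conjE)
  have maps: "G 0 = 0" "map G us = vs" "G 1 = 1" using G(2) by simp_all
  have "x \<in> U" if "x \<in> set (0 # us @ [1])" "self_similar_at G x" for x
  proof -
    have "x \<noteq> 0" "x \<noteq> 1" using that(2) unfolding self_similar_at_def by auto
    then show ?thesis using that(1) us(2) by auto
  qed
  then have "intertwiner U G" using G(1) unfolding intertwiner_def by blast
  moreover have "G ` U = V" using maps(2) us(2) vs(2) by (metis set_map)
  ultimately show thesis using that maps by blast
qed

theorem theorem7p6:
  fixes U V :: "real set"
  assumes "finite U" "U \<subseteq> {0<..<1}"
    and "finite V" "V \<subseteq> {0<..<1}"
    and "type_word U = type_word V"
  shows "conjugate_in tree_group (fixing_subgroup U) (fixing_subgroup V)"
proof -
  obtain G where G: "intertwiner U G" "G 0 = 0" "G 1 = 1" "G ` U = V"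
    by (rule intertwiner_exists[OF assms])
  have "U \<subseteq> I01" using assms(2) by auto
  then show ?thesis using intertwiner_conjugates_fixing_subgroups[OF G(1-3) assms(1)] G(4) by simp
qed

end
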